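(* Let $d\ge1$. Then $MW_2$ defines a metric on $GMM_d(\infty)$, and the space $GMM_d(\infty)$ equipped with the distance $MW_2$ is a geodesic space.
   Context: Gaussian distributions $\mathcal{N}(m,\Sigma)$ on $\mathbb{R}^n$ may be degenerate ($\Sigma$ symmetric positive semi-definite; Dirac masses are included). $GMM_n(K)$ is the set of probability measures on $\mathbb{R}^n$ that can be written $\sum_{k=1}^{K}\pi_k\mathcal{N}(m_k,\Sigma_k)$ with $\pi_k\ge0$, $\sum_k\pi_k=1$, and $GMM_n(\infty)=\bigcup_K GMM_n(K)$ (finite Gaussian mixtures). $\Pi(\mu_0,\mu_1)$ is the set of probability measures on $\mathbb{R}^d\times\mathbb{R}^d$ with marginals $\mu_0,\mu_1$. For $\mu_0,\mu_1\in GMM_d(\infty)$, $MW_2(\mu_0,\mu_1)\ge 0$ is defined by $$MW_2^2(\mu_0,\mu_1) := \inf_{\gamma \in \Pi(\mu_0,\mu_1) \cap GMM_{2d}(\infty)} \int_{\mathbb{R}^d\times\mathbb{R}^d} \|y_0-y_1\|^2d\gamma(y_0,y_1),$$ where $\mathbb{R}^d\times\mathbb{R}^d$ is identified with $\mathbb{R}^{2d}$. For a path $\rho=(\rho_t)_{t\in[0,1]}$ in $GMM_d(\infty)$, its length is $\mathrm{Len}_{MW_2}(\rho)=\sup_{N;\,0=t_0\le t_1\le\dots\le t_N=1}\sum_{i=1}^N MW_2(\rho_{t_{i-1}},\rho_{t_i})\in[0,+\infty]$. The space is geodesic if for all $\mu_0,\mu_1\in GMM_d(\infty)$ there is a path $\rho$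 in $GMM_d(\infty)$, continuous for $MW_2$, with $\rho_0=\mu_0$, $\rho_1=\mu_1$ and $\mathrm{Len}_{MW_2}(\rho)=MW_2(\mu_0,\mu_1)$. *)

theory Defs
  imports "HOL-Probability.Probability"
begin

definition covariance_operator :: "('a::euclidean_space \<Rightarrow> 'a) \<Rightarrow> bool" where
  "covariance_operator S \<longleftrightarrow>
     linear S \<and> (\<forall>x y. S x \<bullet> y = x \<bullet> S y) \<and> (\<forall>x. 0 \<le> x \<bullet> S x)"

text \<open>
  \<open>\<mu>\<close> is the Gaussian distribution with mean \<open>m\<close> and covariance \<open>S\<close>. Since \<open>S\<close> may be singular
  there need not be a density, so the distribution is specified by its characteristic function.
\<close>
definition gaussian :: "'a::euclidean_space \<Rightarrow> ('a \<Rightarrow> 'a) \<Rightarrow> 'a measure \<Rightarrow> bool" where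
  "gaussian m S \<mu> \<longleftrightarrow>
     covariance_operator S \<and> prob_space \<mu> \<and> sets \<mu> = sets borel \<and>
     (\<forall>t. (CLINT x|\<mu>. iexp (t \<bullet> x)) =
          exp (\<i> * complex_of_real (t \<bullet> m) - complex_of_real (t \<bullet> S t) / 2))"

definition GMM :: "nat \<Rightarrow> 'a::euclidean_space measure set" where
  "GMM K = {\<mu>. sets \<mu> = sets borel \<and>
     (\<exists>(w :: nat \<Rightarrow> real) m S G.
        (\<forall>k<K. 0 \<le> w k) \<and> (\<Sum>k<K. w k) = 1 \<and>
        (\<forall>k<K. gaussian (m k) (S k) (G k)) \<and>
        (\<forall>A\<in>sets borel. emeasure \<mu> A = (\<Sum>k<K. ennreal (w k) * emeasure (G k) A)))}"

definition GMM_infinity :: "'a::euclidean_space measure set" where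
  "GMM_infinity = (\<Union>K. GMM K)"

definition couplings ::
    "'a::euclidean_space measure \<Rightarrow> 'a measure \<Rightarrow> ('a \<times> 'a) measure set" where
  "couplings \<mu> \<nu> = {\<gamma>. prob_space \<gamma> \<and> sets \<gamma> = sets borel \<and>
     distr \<gamma> borel fst = \<mu> \<and> distr \<gamma> borel snd = \<nu>}"

text \<open>
  The product type \<open>'a \<times> 'a\<close> is itself a Euclidean space, of twice the dimension and with the
  \<open>\<ell>\<^sup>2\<close> product norm, so \<open>GMM_infinity\<close> below is taken on it.
\<close>
definition MW2_squared :: "'a::euclidean_space measure \<Rightarrow> 'a measure \<Rightarrow> ennreal" where
  "MW2_squared \<mu> \<nu> =
     (INF \<gamma> \<in> couplings \<mu> \<nu> \<inter> GMM_infinity.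
        \<integral>\<^sup>+z. ennreal ((norm (fst z - snd z))\<^sup>2) \<partial>\<gamma>)"

text \<open>
  Because \<open>enn2real \<top> = 0\<close>, this is meaningful only where \<open>MW2_squared\<close> is finite;
  finiteness on \<open>GMM_infinity\<close> has to be established separately.
\<close>
definition MW2 :: "'a::euclidean_space measure \<Rightarrow> 'a measure \<Rightarrow> real" where
  "MW2 \<mu> \<nu> = sqrt (enn2real (MW2_squared \<mu> \<nu>))"

definition metric_length :: "('m \<Rightarrow> 'm \<Rightarrow> real) \<Rightarrow> (real \<Rightarrow> 'm) \<Rightarrow> ennreal" where
  "metric_length d \<rho> =
     (SUP (N, t) \<in> {(N :: nat, t :: nat \<Rightarrow> real).
                      t 0 = 0 \<and> t N = 1 \<and> (\<forall>i<N. t i \<le> t (Suc i))}.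
        ennreal (\<Sum>i<N. d (\<rho> (t i)) (\<rho> (t (Suc i)))))"

definition geodesic_space :: "'m set \<Rightarrow> ('m \<Rightarrow> 'm \<Rightarrow> real) \<Rightarrow> bool" where
  "geodesic_space M d \<longleftrightarrow>
     (\<forall>x\<in>M. \<forall>y\<in>M. \<exists>\<rho>. pathin (Metric_space.mtopology M d) \<rho> \<and>
        \<rho> 0 = x \<and> \<rho> 1 = y \<and> metric_length d \<rho> = ennreal (d x y))"

end

theory Submission
  imports Defs
begin

text \<open>
  A finite Gaussian mixture is the same thing as a finitely supported probability distribution
  over Gaussian laws: \<open>mix p\<close> draws a Gaussian law from \<open>p\<close> and then a point from that law. The
  distribution \<open>p\<close> can be recovered from \<open>mix p\<close> (\<open>mix_inject\<close>): the exponential moments of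
  finitely many distinct Gaussian laws are exponentials of distinct quadratic polynomials, these
  remain distinct on a suitable line through the origin, and on a line the fastest growing one
  cannot be cancelled by the others.

  Therefore a coupling of \<open>mix p\<close> and \<open>mix q\<close> that is itself a Gaussian mixture is exactly a
  measure \<open>mix r\<close>, where \<open>r\<close> is a finitely supported distribution over Gaussian laws on the product
  space whose images under the two marginal maps are \<open>p\<close> and \<open>q\<close> (\<open>GMM_couplings_eq\<close>), and its cost
  is the \<open>r\<close>-average of the costs of the components. Thus \<open>MW2\<close> is an optimal transport distance
  between finitely supported measures on the space of Gaussian laws, and two facts about that
  problem give the theorem.

  The first is that the infimum is attained (\<open>optimal_mixture_coupling\<close>). For two Gaussian laws
  the cost of a Gaussian coupling is a continuous function of its covariance, which ranges over a
  compact set; the component weights then range over a compact polytope, on which the cost is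
  linear. The cost of a Gaussian mixture is finite; a coupling of cost zero is concentrated
  on the diagonal, so \<open>MW2\<close> separates points. Pushing an optimal coupling forward along
  \<open>(x, y) \<mapsto> (1 - t) x + t y\<close> gives a path of Gaussian mixtures, and pushing it forward along two
  such maps at once shows \<open>MW2 (\<rho> s) (\<rho> t) \<le> \<bar>s - t\<bar> * MW2 \<mu> \<nu>\<close>, which forces the length of the path
  to be \<open>MW2 \<mu> \<nu>\<close>.

  The second is that couplings can be composed inside the class of Gaussian mixtures
  (\<open>mixture_coupling_composition\<close>), which gives the triangle inequality. Two Gaussian couplings
  with the same middle marginal are glued by linear regression, so that the glued law is a linear
  image of a product of Gaussian laws and hence Gaussian; identifiability makes the components of two mixture couplings
  with the same middle marginal match up.
\<close>

section \<open>Uniqueness of characteristic functions in Euclidean space\<close>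

text \<open>
  Normalising the total mass, which is the value of the transform at \<open>0\<close>, reduces this to the
  uniqueness theorem for real distributions.
\<close>
lemma finite_measure_eqI_char:
  fixes M N :: "real measure"
  assumes "finite_measure M" "finite_measure N" "sets M = sets borel" "sets N = sets borel"
    and chf: "\<And>t. (CLINT x|M. iexp (t * x)) = (CLINT x|N. iexp (t * x))"
  shows "M = N"
proof -
  interpret M: finite_measure M by fact
  interpret N: finite_measure N by fact
  have [measurable_cong]: "sets M = sets borel" "sets N = sets borel" by fact+
  have sp: "space M = UNIV" "space N = UNIV"
    using assms(3,4) by (auto dest: sets_eq_imp_space_eq)
  define c where "c = measure M UNIV"
  have "complex_of_real (measure M UNIV) = complex_of_real (measure N UNIV)"
    using chf[of 0] sp by simp
  then have cN: "c = measure N UNIV" by (simp add: c_def)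
  show ?thesis
  proof (cases "c = 0")
    case True
    have "emeasure M A = 0" "emeasure N A = 0" if "A \<in> sets borel" for A
      using that True cN emeasure_mono[of A UNIV M] emeasure_mono[of A UNIV N] assms(3,4)
      by (simp_all add: c_def M.emeasure_eq_measure N.emeasure_eq_measure)
    then show ?thesis by (intro measure_eqI) (auto simp: assms)
  next
    case False
    then have c: "c > 0" by (simp add: c_def zero_less_measure_iff less_le)
    define n where "n K = density K (\<lambda>_. ennreal (1 / c))" for K :: "real measure"
    have em: "emeasure (n K) A = ennreal (1 / c) * emeasure K A" if "A \<in> sets K" for K A
      using that unfolding n_def by (rule emeasure_density_const)
    have "real_distribution (n M)"
    proof (intro real_distribution.intro prob_spaceI real_distribution_axioms.intro)
      have "emeasure (n M) (space M) = 1"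
        using c sets.top[of M] unfolding sp
        by (subst em) (auto simp: M.emeasure_eq_measure c_def[symmetric] sp ennreal_mult'[symmetric])
      then show "emeasure (n M) (space (n M)) = 1" by (simp add: n_def)
    qed (simp_all add: n_def assms sp)
    moreover have "real_distribution (n N)"
    proof (intro real_distribution.intro prob_spaceI real_distribution_axioms.intro)
      have "emeasure (n N) (space N) = 1"
        using c sets.top[of N] unfolding sp
        by (subst em) (auto simp: N.emeasure_eq_measure cN[symmetric] sp ennreal_mult'[symmetric])
      then show "emeasure (n N) (space (n N)) = 1" by (simp add: n_def)
    qed (simp_all add: n_def assms sp)
    moreover have "char (n M) = char (n N)"
      unfolding char_def n_def using c
      by (intro ext) (simp add: integral_density assms(3,4) del: of_real_mult, rule chf)
    ultimately have eq: "n M = n N" by (rule Levy_uniqueness)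
    show ?thesis
    proof (rule measure_eqI)
      fix A assume "A \<in> sets M"
      then have "ennreal (1 / c) * emeasure M A = ennreal (1 / c) * emeasure N A"
        using em[of A M] em[of A N] eq assms(3,4) by simp
      then show "emeasure M A = emeasure N A"
        using c by (auto simp: ennreal_mult_cancel_left)
    qed (simp add: assms)
  qed
qed

lemma cos_times_iexp:
  "complex_of_real (cos (y + \<theta>)) * iexp x =
     (iexp \<theta> * iexp (x + y) + iexp (- \<theta>) * iexp (x - y)) / 2"
proof -
  have "complex_of_real (cos (y + \<theta>)) = (iexp \<theta> * iexp y + iexp (- \<theta>) * iexp (- y)) / 2"
    unfolding cos_of_real[symmetric] cos_exp_eq by (simp add: exp_add[symmetric] algebra_simps)
  moreover have "iexp (x + y) = iexp x * iexp y" "iexp (x - y) = iexp x * iexp (- y)"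
    by (simp_all add: exp_add[symmetric] algebra_simps)
  ultimately show ?thesis
    by (simp only:) (simp only: algebra_simps add_divide_distrib times_divide_eq_left times_divide_eq_right)
qed

text \<open>
  One-dimensional uniqueness is lifted to Euclidean space one coordinate at a time. To add the
  coordinate \<open>b\<close> to \<open>C\<close>, write \<open>h\<close> for the product of indicators already treated. The measures with
  complex density \<open>h x * iexp (t \<bullet> x)\<close> are out of reach of a theorem on positive measures, but the
  densities \<open>h x * (1 + cos (t \<bullet> x + \<theta>))\<close> are nonnegative, and the transform of their image under
  \<open>x \<mapsto> x \<bullet> b\<close> at \<open>s\<close> is a combination of the integrals of \<open>h x * iexp (u \<bullet> x)\<close> at the points
  \<open>u = s *\<^sub>R b\<close> and \<open>u = s *\<^sub>R b \<plusminus> t\<close>, where both measures agree by induction. Varying the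
  phase \<open>\<theta>\<close> recovers the real and imaginary parts.
\<close>
lemma integral_cylinder_iexp_eq:
  fixes M N :: "'a::euclidean_space measure"
  assumes "prob_space M" "prob_space N" "sets M = sets borel" "sets N = sets borel"
    and chf: "\<And>t. (CLINT x|M. iexp (t \<bullet> x)) = (CLINT x|N. iexp (t \<bullet> x))"
    and "finite C" and "\<And>b. b \<in> C \<Longrightarrow> A b \<in> sets borel"
  shows "(CLINT x|M. complex_of_real (\<Prod>b\<in>C. indicator (A b) (x \<bullet> b)) * iexp (t \<bullet> x)) =
         (CLINT x|N. complex_of_real (\<Prod>b\<in>C. indicator (A b) (x \<bullet> b)) * iexp (t \<bullet> x))"
  using \<open>finite C\<close> assms(7)
proof (induction C arbitrary: t rule: finite_induct)
  case empty
  then show ?case using chf by simp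
next
  case (insert b C)
  interpret M: prob_space M by fact
  interpret N: prob_space N by fact
  have [measurable_cong]: "sets M = sets borel" "sets N = sets borel" by fact+
  have A[measurable]: "A b \<in> sets borel" using insert.prems by auto
  define h where "h x = (\<Prod>b\<in>C. indicator (A b) (x \<bullet> b) :: real)" for x
  have h[measurable]: "h \<in> borel_measurable borel"
    unfolding h_def using insert.prems by (intro borel_measurable_prod) (auto intro!: measurable_compose[OF _ borel_measurable_indicator])
  have h01: "0 \<le> h x" "h x \<le> 1" for x
    unfolding h_def by (auto intro!: prod_nonneg prod_le_1)
  have IH: "(CLINT x|M. complex_of_real (h x) * iexp (t \<bullet> x)) = (CLINT x|N. complex_of_real (h x) * iexp (t \<bullet> x))" for t
    using insert unfolding h_def by blast
  define w where "w \<theta> x = h x * (1 + cos (t \<bullet> x + \<theta>))" for \<theta> x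
  have w[measurable]: "w \<theta> \<in> borel_measurable borel" for \<theta>
    unfolding w_def by measurable
  have cos01: "0 \<le> 1 + cos y" "1 + cos y \<le> 2" for y :: real
    using cos_ge_minus_one[of y] cos_le_one[of y] by linarith+
  have w0: "0 \<le> w \<theta> x" for \<theta> x
    unfolding w_def by (intro mult_nonneg_nonneg h01 cos01)
  have w2: "w \<theta> x \<le> 2" for \<theta> x
    unfolding w_def using mult_mono[OF h01(2)[of x] cos01(2) _ cos01(1)] by simp
  define D where "D \<theta> K = distr (density K (\<lambda>x. ennreal (w \<theta> x))) borel (\<lambda>x. x \<bullet> b)" for \<theta> and K :: "'a measure"
  have key: "(CLINT x|K. complex_of_real (w \<theta> x) * iexp (s * (x \<bullet> b))) =
     (CLINT x|K. complex_of_real (h x) * iexp ((s *\<^sub>R b) \<bullet> x)) +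
     (iexp \<theta> * (CLINT x|K. complex_of_real (h x) * iexp ((s *\<^sub>R b + t) \<bullet> x)) +
     iexp (- \<theta>) * (CLINT x|K. complex_of_real (h x) * iexp ((s *\<^sub>R b - t) \<bullet> x))) / 2"
    if "prob_space K" and [measurable_cong]: "sets K = sets borel" for K \<theta> s
  proof -
    interpret K: prob_space K by fact
    define f where "f u x = complex_of_real (h x) * iexp (u \<bullet> x)" for u x
    have int: "integrable K (f u)" for u
      unfolding f_def by (rule K.integrable_const_bound[of _ 1]) (use h01 in \<open>auto simp: norm_mult\<close>)
    have "complex_of_real (w \<theta> x) * iexp (s * (x \<bullet> b)) =
      f (s *\<^sub>R b) x + (iexp \<theta> * f (s *\<^sub>R b + t) x + iexp (- \<theta>) * f (s *\<^sub>R b - t) x) / 2" for x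
    proof -
      have "complex_of_real (w \<theta> x) * iexp (s * (x \<bullet> b)) =
        complex_of_real (h x) * iexp (s * (x \<bullet> b)) +
        complex_of_real (h x) * (complex_of_real (cos (t \<bullet> x + \<theta>)) * iexp (s * (x \<bullet> b)))"
        by (simp add: w_def algebra_simps)
      then show ?thesis
        unfolding cos_times_iexp f_def
        by (simp add: inner_add_left inner_diff_left inner_commute[of b x] algebra_simps)
    qed
    then show ?thesis
      unfolding f_def[symmetric] using int by simp
  qed
  have eqD: "D \<theta> M = D \<theta> N" for \<theta>
  proof (rule finite_measure_eqI_char)
    have fin: "finite_measure (D \<theta> K)" if "prob_space K" and [measurable_cong]: "sets K = sets borel" for K
    proof -
      interpret K: prob_space K by fact
      have "(\<integral>\<^sup>+x. ennreal (w \<theta> x) \<partial>K) \<le> (\<integral>\<^sup>+x. 2 \<partial>K)"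
        using w2 by (intro nn_integral_mono) (auto simp flip: ennreal_numeral)
      then have "(\<integral>\<^sup>+x. ennreal (w \<theta> x) \<partial>K) < \<infinity>"
        using K.emeasure_space_1 by (auto intro: le_less_trans)
      then have "finite_measure (density K (\<lambda>x. ennreal (w \<theta> x)))"
        by (intro finite_measureI) (auto simp: emeasure_density cong: nn_integral_cong)
      then show ?thesis unfolding D_def by (rule finite_measure.finite_measure_distr) auto
    qed
    show "finite_measure (D \<theta> M)" "finite_measure (D \<theta> N)" using fin assms by auto
    fix s
    show "(CLINT x|D \<theta> M. iexp (s * x)) = (CLINT x|D \<theta> N. iexp (s * x))"
    proof -
      have "(CLINT x|D \<theta> K. iexp (s * x)) = (CLINT x|K. complex_of_real (w \<theta> x) * iexp (s * (x \<bullet> b)))"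
        if [measurable_cong]: "sets K = sets borel" for K
        unfolding D_def using w0 by (simp add: integral_distr integral_density scaleR_conv_of_real)
      then show ?thesis
        using assms(1-4) by (simp only: key IH)
    qed
  qed (simp_all add: D_def)
  have cosint: "(LINT x|M. w \<theta> x * indicator (A b) (x \<bullet> b)) = (LINT x|N. w \<theta> x * indicator (A b) (x \<bullet> b))" for \<theta>
  proof -
    have "(LINT x|D \<theta> K. indicator (A b) x) = (LINT x|K. w \<theta> x * indicator (A b) (x \<bullet> b))"
      if [measurable_cong]: "sets K = sets borel" for K
      unfolding D_def using w0
      by (subst integral_distr) (auto simp: integral_density simp del: Bochner_Integration.integral_indicator)
    then show ?thesis using eqD assms(3,4) by metis
  qed
  define g where "g x = h x * indicator (A b) (x \<bullet> b)" for x
  have g[measurable]: "g \<in> borel_measurable borel" unfolding g_def by measurable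
  have g01: "\<bar>g x\<bar> \<le> 1" for x
    using h01 unfolding g_def by (auto simp: indicator_def)
  have split: "(LINT x|K. w \<theta> x * indicator (A b) (x \<bullet> b)) = (LINT x|K. g x) + (LINT x|K. g x * cos (t \<bullet> x + \<theta>))"
    if "prob_space K" and [measurable_cong]: "sets K = sets borel" for K \<theta>
  proof -
    interpret K: prob_space K by fact
    have "integrable K g" by (rule K.integrable_const_bound[of _ 1]) (auto simp: g01)
    moreover have "integrable K (\<lambda>x. g x * cos (t \<bullet> x + \<theta>))"
      by (rule K.integrable_const_bound[of _ 1]) (auto simp: abs_mult intro!: mult_le_one g01)
    moreover have "(\<lambda>x. w \<theta> x * indicator (A b) (x \<bullet> b)) = (\<lambda>x. g x + g x * cos (t \<bullet> x + \<theta>))"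
      by (auto simp: w_def g_def algebra_simps)
    ultimately show ?thesis by simp
  qed
  have sum0: "(LINT x|M. g x) + (LINT x|M. g x * cos (t \<bullet> x + \<theta>)) = (LINT x|N. g x) + (LINT x|N. g x * cos (t \<bullet> x + \<theta>))" for \<theta>
    using cosint[of \<theta>] split assms(1-4) by simp
  \<comment> \<open>Phases differing by \<open>pi\<close> give opposite cosines, so adding the two identities leaves the constant term.\<close>
  have "cos (y + pi) = - cos y" for y :: real by simp
  then have gint: "(LINT x|M. g x) = (LINT x|N. g x)"
    using sum0[of 0] sum0[of pi] by simp
  have "(CLINT x|K. complex_of_real (g x) * iexp (t \<bullet> x)) =
     complex_of_real (LINT x|K. g x * cos (t \<bullet> x + 0)) + \<i> * complex_of_real (LINT x|K. g x * cos (t \<bullet> x + - (pi/2)))"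
    if "prob_space K" and [measurable_cong]: "sets K = sets borel" for K
  proof -
    interpret K: prob_space K by fact
    have int: "integrable K (\<lambda>x. g x * cos (t \<bullet> x + \<theta>))" for \<theta>
      by (rule K.integrable_const_bound[of _ 1]) (auto simp: abs_mult intro!: mult_le_one g01)
    have "(CLINT x|K. complex_of_real (g x) * iexp (t \<bullet> x)) =
      (CLINT x|K. complex_of_real (g x * cos (t \<bullet> x + 0)) + \<i> * complex_of_real (g x * cos (t \<bullet> x + - (pi/2))))"
      by (intro Bochner_Integration.integral_cong refl)
         (simp add: exp_Euler cos_of_real sin_of_real cos_diff algebra_simps)
    also have "\<dots> = complex_of_real (LINT x|K. g x * cos (t \<bullet> x + 0)) + \<i> * complex_of_real (LINT x|K. g x * cos (t \<bullet> x + - (pi/2)))"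
      using int[of 0] int[of "-(pi/2)"]
      by (subst Bochner_Integration.integral_add) (auto simp del: of_real_mult)
    finally show ?thesis .
  qed
  then have "(CLINT x|M. complex_of_real (g x) * iexp (t \<bullet> x)) = (CLINT x|N. complex_of_real (g x) * iexp (t \<bullet> x))"
    using sum0[of 0] sum0[of "-(pi/2)"] gint assms(1-4) by simp
  then show ?case
    unfolding g_def h_def using insert.hyps by (simp add: mult_ac)
qed

text \<open>
  With all coordinates treated and \<open>t = 0\<close>, the preceding lemma says that both measures agree on
  cylinders, an intersection stable generator of the Borel sets.
\<close>
theorem measure_eqI_characteristic:
  fixes M N :: "'a::euclidean_space measure"
  assumes "prob_space M" "prob_space N" "sets M = sets borel" "sets N = sets borel"
    and chf: "\<And>t. (CLINT x|M. iexp (t \<bullet> x)) = (CLINT x|N. iexp (t \<bullet> x))"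
  shows "M = N"
proof -
  interpret M: prob_space M by fact
  interpret N: prob_space N by fact
  have [measurable_cong]: "sets M = sets borel" "sets N = sets borel" by fact+
  define cyl where "cyl A = {x::'a. \<forall>b\<in>Basis. x \<bullet> b \<in> A b}" for A :: "'a \<Rightarrow> real set"
  define E where "E = cyl ` {A. \<forall>b. A b \<in> sets borel}"
  have Eb: "E \<subseteq> sets borel" unfolding E_def cyl_def by auto
  have "sigma_sets UNIV E = sets borel"
  proof
    show "sigma_sets UNIV E \<subseteq> sets borel"
      using Eb sets.sigma_sets_subset[of E borel] by simp
    have "box a b = cyl (\<lambda>i. {a \<bullet> i <..< b \<bullet> i})" for a b by (auto simp: box_def cyl_def)
    then have "range (\<lambda>(a, b). box a b :: 'a set) \<subseteq> E"
      unfolding E_def by auto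
    then show "sets borel \<subseteq> sigma_sets UNIV E"
      unfolding borel_eq_box by (subst sets_measure_of) (simp_all add: sigma_sets_mono')
  qed
  then show ?thesis
  proof (intro measure_eqI_generator_eq[where E=E and \<Omega>=UNIV and A="\<lambda>_. UNIV"])
    have "cyl A \<inter> cyl B = cyl (\<lambda>b. A b \<inter> B b)" for A B by (auto simp: cyl_def)
    then show "Int_stable E"
      unfolding E_def by (intro Int_stableI) auto
    fix X assume "X \<in> E"
    then obtain A where X: "X = cyl A" and A: "\<And>b. A b \<in> sets borel"
      unfolding E_def by blast
    have ind: "(\<Prod>b\<in>Basis. indicator (A b) (x \<bullet> b)) = (indicator X x :: real)" for x
      by (cases "x \<in> X") (auto simp: X cyl_def indicator_def intro!: prod_zero)
    have "X \<in> sets borel" using \<open>X \<in> E\<close> Eb by auto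
    moreover have "(CLINT x|M. complex_of_real (\<Prod>b\<in>Basis. indicator (A b) (x \<bullet> b)) * iexp (0 \<bullet> x)) =
         (CLINT x|N. complex_of_real (\<Prod>b\<in>Basis. indicator (A b) (x \<bullet> b)) * iexp (0 \<bullet> x))"
      by (rule integral_cylinder_iexp_eq[OF assms(1-4) chf finite_Basis A])
    ultimately have "complex_of_real (measure M X) = complex_of_real (measure N X)"
      unfolding ind by (simp add: assms(3,4))
    then show "emeasure M X = emeasure N X"
      by (simp add: M.emeasure_eq_measure N.emeasure_eq_measure)
  next
    have "UNIV = cyl (\<lambda>_. UNIV)" by (auto simp: cyl_def)
    then show "range (\<lambda>_. UNIV) \<subseteq> E" unfolding E_def by auto
  qed (auto simp: assms)
qed

section \<open>Degenerate Gaussian laws\<close>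

text \<open>
  The usual discriminant argument; the form may be degenerate, so \<open>c = 0\<close> is treated apart.
\<close>
lemma covariance_operator_cauchy_schwarz:
  assumes "covariance_operator S"
  shows "(x \<bullet> S y)\<^sup>2 \<le> (x \<bullet> S x) * (y \<bullet> S y)"
proof -
  have lin: "linear S" and sym: "\<And>x y. S x \<bullet> y = x \<bullet> S y" and pos: "\<And>x. 0 \<le> x \<bullet> S x"
    using assms by (auto simp: covariance_operator_def)
  define a b c where "a = x \<bullet> S x" and "b = x \<bullet> S y" and "c = y \<bullet> S y"
  have ineq: "0 \<le> a + 2 * s * b + s\<^sup>2 * c" for s
  proof -
    have "y \<bullet> S x = b" using sym[of x y] by (simp add: b_def inner_commute)
    then have "(x + s *\<^sub>R y) \<bullet> S (x + s *\<^sub>R y) = a + 2 * s * b + s\<^sup>2 * c"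
      by (simp add: linear_add[OF lin] linear_scale[OF lin] inner_add_left inner_add_right
          a_def b_def c_def power2_eq_square algebra_simps)
    then show ?thesis using pos by metis
  qed
  have "b\<^sup>2 \<le> a * c"
  proof (cases "c = 0")
    case True
    have "b = 0"
    proof (rule ccontr)
      assume "b \<noteq> 0"
      \<comment> \<open>At this argument the affine function \<open>s \<mapsto> a + 2 * s * b\<close> is negative.\<close>
      then have "2 * (- (a + 1) / (2 * b)) * b = - (a + 1)" by simp
      with True ineq[of "- (a + 1) / (2 * b)"] show False by simp
    qed
    then show ?thesis using True by simp
  next
    case False
    then have "c > 0" using pos[of y] by (simp add: c_def less_le)
    with ineq[of "- b / c"] show ?thesis
      by (simp add: power2_eq_square field_simps)
  qed
  then show ?thesis by (simp add: a_def b_def c_def)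
qed

lemma covariance_operator_null:
  assumes "covariance_operator S" "x \<bullet> S x = 0"
  shows "S x = 0"
proof -
  have "(S x \<bullet> S x)\<^sup>2 \<le> 0"
    using covariance_operator_cauchy_schwarz[OF assms(1), of "S x" x] assms(2) by simp
  then show ?thesis by simp
qed

lemma borel_measurable_linear:
  fixes L :: "'a::euclidean_space \<Rightarrow> 'b::real_normed_vector"
  shows "linear L \<Longrightarrow> L \<in> borel_measurable borel"
  by (intro borel_measurable_continuous_onI linear_continuous_on) (simp add: linear_conv_bounded_linear)

lemma gaussian_eqI: "gaussian m S M \<Longrightarrow> gaussian m S N \<Longrightarrow> M = N"
  by (rule measure_eqI_characteristic) (auto simp: gaussian_def)

text \<open>
  All further constructions of Gaussian laws (marginals, sums, regression residuals,
  interpolations) are linear images of products, so this lemma and the next one are all that is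
  needed to see that they are Gaussian and to read off their parameters.
\<close>
lemma gaussian_linear_image:
  fixes L :: "'a::euclidean_space \<Rightarrow> 'b::euclidean_space"
  assumes "gaussian m S M" "linear L"
  shows "gaussian (L m) (\<lambda>y. L (S (adjoint L y))) (distr M borel L)"
proof -
  have S: "covariance_operator S" and sets[measurable_cong]: "sets M = sets borel" and "prob_space M"
    and chf: "\<And>t. (CLINT x|M. iexp (t \<bullet> x)) =
          exp (\<i> * complex_of_real (t \<bullet> m) - complex_of_real (t \<bullet> S t) / 2)"
    using assms(1) by (auto simp: gaussian_def)
  have [measurable]: "L \<in> borel_measurable borel" using borel_measurable_linear assms(2) .
  have adj: "t \<bullet> L x = adjoint L t \<bullet> x" for t x
    using adjoint_works[OF assms(2), of x t] by (simp add: inner_commute)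
  have "covariance_operator (\<lambda>y. L (S (adjoint L y)))"
    using S adjoint_linear[OF assms(2)] assms(2) unfolding covariance_operator_def
    by (auto simp: adj inner_commute[of "L _"] intro: linear_compose[unfolded o_def])
       (metis inner_commute)
  moreover have "(CLINT x|distr M borel L. iexp (t \<bullet> x)) =
     exp (\<i> * complex_of_real (t \<bullet> L m) - complex_of_real (t \<bullet> L (S (adjoint L t))) / 2)" for t
    using chf[of "adjoint L t"] by (simp add: integral_distr adj)
  ultimately show ?thesis
    unfolding gaussian_def using prob_space.prob_space_distr[OF \<open>prob_space M\<close>, of L borel] by auto
qed

lemma gaussian_pair:
  fixes M :: "'a::euclidean_space measure" and N :: "'b::euclidean_space measure"
  assumes "gaussian m S M" "gaussian n T N"
  shows "gaussian (m, n) (\<lambda>z. (S (fst z), T (snd z))) (M \<Otimes>\<^sub>M N)"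
proof -
  have S: "covariance_operator S" and sM[measurable_cong]: "sets M = sets borel" and "prob_space M"
    and chfM: "\<And>t. (CLINT x|M. iexp (t \<bullet> x)) =
          exp (\<i> * complex_of_real (t \<bullet> m) - complex_of_real (t \<bullet> S t) / 2)"
    using assms(1) by (auto simp: gaussian_def)
  have T: "covariance_operator T" and sN[measurable_cong]: "sets N = sets borel" and "prob_space N"
    and chfN: "\<And>t. (CLINT x|N. iexp (t \<bullet> x)) =
          exp (\<i> * complex_of_real (t \<bullet> n) - complex_of_real (t \<bullet> T t) / 2)"
    using assms(2) by (auto simp: gaussian_def)
  interpret M: prob_space M by fact
  interpret N: prob_space N by fact
  interpret MN: pair_prob_space M N by unfold_locales
  have ST: "covariance_operator (\<lambda>z. (S (fst z), T (snd z)))"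
    using S T unfolding covariance_operator_def
    by (auto simp: linear_iff inner_prod_def)
  have sets: "sets (M \<Otimes>\<^sub>M N) = sets borel"
    using sets_pair_measure_cong[OF sM sN] unfolding borel_prod .
  have "(CLINT z|M \<Otimes>\<^sub>M N. iexp (t \<bullet> z)) =
     exp (\<i> * complex_of_real (t \<bullet> (m, n)) - complex_of_real (t \<bullet> (S (fst t), T (snd t))) / 2)" for t
  proof -
    have "(CLINT z|M \<Otimes>\<^sub>M N. iexp (t \<bullet> z)) = (CLINT x|M. CLINT y|N. iexp (t \<bullet> (x, y)))"
    proof (rule MN.integral_fst'[symmetric])
      show "integrable (M \<Otimes>\<^sub>M N) (\<lambda>z. iexp (t \<bullet> z))"
        unfolding inner_prod_def by (rule MN.integrable_const_bound[of _ 1]) auto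
    qed
    also have "\<dots> = (CLINT x|M. iexp (fst t \<bullet> x)) * (CLINT y|N. iexp (snd t \<bullet> y))"
      by (simp add: inner_prod_def distrib_left exp_add)
    finally show ?thesis
      unfolding chfM chfN by (simp add: inner_prod_def exp_add[symmetric] algebra_simps add_divide_distrib)
  qed
  then show ?thesis
    unfolding gaussian_def using ST sets MN.prob_space_axioms by blast
qed

lemma gaussian_dirac: "gaussian m (\<lambda>_. 0) (return borel m)"
  unfolding gaussian_def covariance_operator_def
  by (auto simp: linear_iff integral_return intro!: prob_space_return)

lemma gaussian_add:
  fixes M N :: "'a::euclidean_space measure"
  assumes "gaussian m S M" "gaussian n T N"
  shows "gaussian (m + n) (\<lambda>x. S x + T x) (distr (M \<Otimes>\<^sub>M N) borel (\<lambda>z. fst z + snd z))"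
proof -
  have lin: "linear (\<lambda>z::'a\<times>'a. fst z + snd z)" by (auto simp: linear_iff algebra_simps)
  have "adjoint (\<lambda>z::'a\<times>'a. fst z + snd z) = (\<lambda>x. (x, x))"
    by (rule adjoint_unique) (auto simp: inner_prod_def algebra_simps)
  then show ?thesis
    using gaussian_linear_image[OF gaussian_pair[OF assms] lin] by simp
qed

lemma gaussian_std_normal: "gaussian 0 (\<lambda>x. x) std_normal_distribution"
proof -
  have "(CLINT x|std_normal_distribution. iexp (t \<bullet> x)) = exp (- complex_of_real (t\<^sup>2) / 2)" for t
    using fun_cong[OF char_std_normal_distribution, of t] unfolding char_def
    by (simp add: exp_of_real[symmetric])
  then show ?thesis
    unfolding gaussian_def covariance_operator_def
    using real_distribution.axioms(1)[OF real_dist_normal_dist] by (simp add: power2_eq_square linear_iff)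
qed

text \<open>
  Induction on the rank of \<open>S\<close>: if \<open>x \<bullet> S x > 0\<close>, then
  subtracting from \<open>S\<close> the rank-one form along \<open>v = S x / sqrt (x \<bullet> S x)\<close> leaves, by Cauchy-Schwarz, a
  covariance operator of smaller rank (it kills \<open>x\<close>), and adding an independent real normal
  variable times \<open>v\<close> puts the rank-one form back.
\<close>
theorem gaussian_exists:
  fixes S :: "'a::euclidean_space \<Rightarrow> 'a"
  assumes "covariance_operator S"
  shows "\<exists>M. gaussian m S M"
  using assms
proof (induction "dim (range S)" arbitrary: S rule: less_induct)
  case less
  have lin: "linear S" and sym: "\<And>x y. S x \<bullet> y = x \<bullet> S y" and pos: "\<And>x. 0 \<le> x \<bullet> S x"
    using less.prems by (auto simp: covariance_operator_def)
  show ?case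
  proof (cases "\<forall>x. x \<bullet> S x = 0")
    case True
    then have "S = (\<lambda>_. 0)" using covariance_operator_null[OF less.prems] by auto
    then show ?thesis using gaussian_dirac by blast
  next
    case False
    then obtain x where "x \<bullet> S x \<noteq> 0" by blast
    then have q: "x \<bullet> S x > 0" using pos[of x] by simp
    define v where "v = S x /\<^sub>R sqrt (x \<bullet> S x)"
    define S' where "S' y = S y - (v \<bullet> y) *\<^sub>R v" for y
    have v: "v \<bullet> y = (x \<bullet> S y) / sqrt (x \<bullet> S x)" for y
      using sym by (simp add: v_def divide_inverse mult.commute)
    have lin': "linear S'"
      using lin unfolding S'_def by (auto simp: linear_iff algebra_simps)
    have sym': "S' y \<bullet> z = y \<bullet> S' z" for y z
      using sym by (simp add: S'_def inner_diff_left inner_diff_right inner_commute)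
    have S': "covariance_operator S'"
      unfolding covariance_operator_def
    proof (intro conjI allI lin' sym')
      fix y
      have "(v \<bullet> y)\<^sup>2 \<le> y \<bullet> S y"
        using covariance_operator_cauchy_schwarz[OF less.prems, of x y] q
        by (simp add: v power_divide divide_le_eq mult.commute)
      then show "0 \<le> y \<bullet> S' y"
        by (simp add: S'_def inner_diff_right inner_commute power2_eq_square)
    qed
    have "S' x = 0"
      using q by (simp add: S'_def v real_div_sqrt) (simp add: v_def)
    have "range S' \<subseteq> range S"
    proof safe
      fix y
      have "S' y = S (y - ((v \<bullet> y) / sqrt (x \<bullet> S x)) *\<^sub>R x)"
        by (simp add: S'_def v_def linear_diff[OF lin] linear_scale[OF lin] divide_inverse)
      then show "S' y \<in> range S" by blast
    qed
    moreover have "S x \<notin> range S'"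
    proof
      assume "S x \<in> range S'"
      then obtain y where "S x = S' y" by blast
      then have "S x \<bullet> x = y \<bullet> S' x" by (simp add: sym')
      then show False using q \<open>S' x = 0\<close> by (simp add: inner_commute)
    qed
    ultimately have "range S' \<subset> range S" by blast
    moreover have "span (range S') = range S'" "span (range S) = range S"
      using linear_span_image[OF lin', of UNIV] linear_span_image[OF lin, of UNIV] by simp_all
    ultimately have "dim (range S') < dim (range S)"
      by (intro dim_psubset) (simp only:)
    from less.hyps[OF this S'] obtain M where M: "gaussian m S' M" ..
    have lv: "linear (\<lambda>r. r *\<^sub>R v)" by (auto simp: linear_iff algebra_simps)
    have "adjoint (\<lambda>r. r *\<^sub>R v) = (\<lambda>y. v \<bullet> y)" by (rule adjoint_unique) auto
    then have "gaussian 0 (\<lambda>y. (v \<bullet> y) *\<^sub>R v) (distr std_normal_distribution borel (\<lambda>r. r *\<^sub>R v))"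
      using gaussian_linear_image[OF gaussian_std_normal lv] by simp
    from gaussian_add[OF M this] have "\<exists>N. gaussian m (\<lambda>y. S' y + (v \<bullet> y) *\<^sub>R v) N" by auto
    moreover have "(\<lambda>y. S' y + (v \<bullet> y) *\<^sub>R v) = S" by (simp add: S'_def)
    ultimately show ?thesis by simp
  qed
qed

text \<open>
  Every linear functional of a Gaussian vector is an affine image of a standard normal variable.
  This covers the degenerate case uniformly, and moments of Gaussian laws become integrals against
  the standard normal density.
\<close>
lemma gaussian_projection:
  assumes "gaussian m S M"
  shows "distr M borel (\<lambda>x. u \<bullet> x) =
         distr std_normal_distribution borel (\<lambda>z. u \<bullet> m + sqrt (u \<bullet> S u) * z)"
proof -
  interpret M: prob_space M using assms by (simp add: gaussian_def)
  interpret N: prob_space std_normal_distribution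
    using real_distribution.axioms(1)[OF real_dist_normal_dist] .
  have [measurable_cong]: "sets M = sets borel" using assms by (simp add: gaussian_def)
  have lin: "linear S" and pos: "0 \<le> u \<bullet> S u" using assms by (auto simp: gaussian_def covariance_operator_def)
  show ?thesis
  proof (rule measure_eqI_characteristic)
    fix t :: real
    have "(CLINT x|distr M borel (\<lambda>x. u \<bullet> x). iexp (t \<bullet> x)) = (CLINT x|M. iexp ((t *\<^sub>R u) \<bullet> x))"
      by (simp add: integral_distr)
    also have "\<dots> = exp (\<i> * complex_of_real ((t *\<^sub>R u) \<bullet> m) - complex_of_real ((t *\<^sub>R u) \<bullet> S (t *\<^sub>R u)) / 2)"
      using assms unfolding gaussian_def by blast
    also have "\<dots> = iexp (t * (u \<bullet> m)) * exp (- complex_of_real ((t * sqrt (u \<bullet> S u))\<^sup>2) / 2)"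
      using pos by (simp add: exp_add[symmetric] linear_scale[OF lin] power_mult_distrib power2_eq_square mult_ac)
    also have "\<dots> = iexp (t * (u \<bullet> m)) * char std_normal_distribution (t * sqrt (u \<bullet> S u))"
      unfolding char_std_normal_distribution by (simp add: exp_of_real[symmetric])
    also have "\<dots> = (CLINT z|std_normal_distribution. iexp (t \<bullet> (u \<bullet> m + sqrt (u \<bullet> S u) * z)))"
      unfolding char_def by (simp add: distrib_left exp_add mult_ac)
    also have "\<dots> = (CLINT x|distr std_normal_distribution borel (\<lambda>z. u \<bullet> m + sqrt (u \<bullet> S u) * z). iexp (t \<bullet> x))"
      by (simp add: integral_distr)
    finally show "(CLINT x|distr M borel (\<lambda>x. u \<bullet> x). iexp (t \<bullet> x)) = \<dots>" .
  qed (auto intro!: M.prob_space_distr N.prob_space_distr)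
qed

lemma gaussian_exp_moment:
  assumes "gaussian m S M"
  shows "(\<integral>\<^sup>+x. ennreal (exp (u \<bullet> x)) \<partial>M) = ennreal (exp (u \<bullet> m + (u \<bullet> S u) / 2))"
proof -
  have [measurable_cong]: "sets M = sets borel" using assms by (simp add: gaussian_def)
  have pos: "0 \<le> u \<bullet> S u" using assms by (auto simp: gaussian_def covariance_operator_def)
  define \<sigma> where "\<sigma> = sqrt (u \<bullet> S u)"
  have s2: "\<sigma>\<^sup>2 = u \<bullet> S u" using pos by (simp add: \<sigma>_def)
  \<comment> \<open>Completing the square gives a normal density centred at \<open>\<sigma>\<close>.\<close>
  have dens: "std_normal_density z * exp (u \<bullet> m + \<sigma> * z) = exp (u \<bullet> m + \<sigma>\<^sup>2 / 2) * normal_density \<sigma> 1 z" for z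
    by (simp add: normal_density_def exp_add[symmetric] power2_eq_square field_simps)
  have "(\<integral>\<^sup>+x. ennreal (exp (u \<bullet> x)) \<partial>M) = (\<integral>\<^sup>+x. ennreal (exp x) \<partial>distr M borel (\<lambda>x. u \<bullet> x))"
    by (simp add: nn_integral_distr)
  also have "\<dots> = (\<integral>\<^sup>+z. ennreal (exp (u \<bullet> m + \<sigma> * z)) \<partial>std_normal_distribution)"
    unfolding gaussian_projection[OF assms] by (simp add: nn_integral_distr \<sigma>_def)
  also have "\<dots> = (\<integral>\<^sup>+z. ennreal (std_normal_density z * exp (u \<bullet> m + \<sigma> * z)) \<partial>lborel)"
    by (subst nn_integral_density) (auto simp: ennreal_mult)
  also have "\<dots> = (\<integral>\<^sup>+z. ennreal (exp (u \<bullet> m + \<sigma>\<^sup>2 / 2)) * ennreal (normal_density \<sigma> 1 z) \<partial>lborel)"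
    unfolding dens by (simp add: ennreal_mult)
  also have "\<dots> = ennreal (exp (u \<bullet> m + \<sigma>\<^sup>2 / 2)) * (\<integral>\<^sup>+z. ennreal (normal_density \<sigma> 1 z) \<partial>lborel)"
    by (rule nn_integral_cmult) auto
  also have "(\<integral>\<^sup>+z. ennreal (normal_density \<sigma> 1 z) \<partial>lborel) = 1"
    by (subst nn_integral_eq_integral) (auto simp: integrable_normal_density integral_normal_density)
  finally show ?thesis by (simp add: s2)
qed

lemma gaussian_second_moment:
  assumes "gaussian m S M"
  shows "(\<integral>\<^sup>+x. ennreal ((norm x)\<^sup>2) \<partial>M) = ennreal ((norm m)\<^sup>2 + (\<Sum>b\<in>Basis. b \<bullet> S b))"
proof -
  have [measurable_cong]: "sets M = sets borel" using assms by (simp add: gaussian_def)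
  have pos: "0 \<le> b \<bullet> S b" for b using assms by (auto simp: gaussian_def covariance_operator_def)
  interpret N: prob_space std_normal_distribution
    using real_distribution.axioms(1)[OF real_dist_normal_dist] .
  have coord: "(\<integral>\<^sup>+x. ennreal ((b \<bullet> x)\<^sup>2) \<partial>M) = ennreal ((b \<bullet> m)\<^sup>2 + b \<bullet> S b)" for b
  proof -
    define a \<sigma> where "a = b \<bullet> m" and "\<sigma> = sqrt (b \<bullet> S b)"
    note i = integrable_std_normal_distribution_moment[of 1] integrable_std_normal_distribution_moment[of 2]
    have m1: "(LINT x|std_normal_distribution. x) = 0"
      using integral_std_normal_distribution_moment_odd[of 1] by simp
    have m2: "(LINT x|std_normal_distribution. x\<^sup>2) = 1"
      using std_normal_distribution_even_moments(1)[of 1] by (simp add: fact_numeral)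
    have exp: "(\<lambda>z. (a + \<sigma> * z)\<^sup>2) = (\<lambda>z. a\<^sup>2 + (2 * a * \<sigma>) * z + \<sigma>\<^sup>2 * z\<^sup>2)"
      by (auto simp: power2_eq_square algebra_simps)
    have "(\<integral>\<^sup>+x. ennreal ((b \<bullet> x)\<^sup>2) \<partial>M) = (\<integral>\<^sup>+x. ennreal (x\<^sup>2) \<partial>distr M borel (\<lambda>x. b \<bullet> x))"
      by (simp add: nn_integral_distr)
    also have "\<dots> = (\<integral>\<^sup>+z. ennreal ((a + \<sigma> * z)\<^sup>2) \<partial>std_normal_distribution)"
      unfolding gaussian_projection[OF assms] by (simp add: nn_integral_distr a_def \<sigma>_def)
    also have "\<dots> = ennreal (LINT z|std_normal_distribution. (a + \<sigma> * z)\<^sup>2)"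
      using i by (intro nn_integral_eq_integral) (simp_all add: exp)
    also have "(LINT z|std_normal_distribution. (a + \<sigma> * z)\<^sup>2) = a\<^sup>2 + \<sigma>\<^sup>2"
      unfolding exp using i by (simp add: m1 m2 N.prob_space[simplified])
    finally show ?thesis using pos by (simp add: a_def \<sigma>_def)
  qed
  have nrm: "(norm x)\<^sup>2 = (\<Sum>b\<in>Basis. (b \<bullet> x)\<^sup>2)" for x :: 'a
    by (subst power2_norm_eq_inner, subst euclidean_inner) (simp add: power2_eq_square inner_commute)
  have "(\<integral>\<^sup>+x. ennreal ((norm x)\<^sup>2) \<partial>M) = (\<integral>\<^sup>+x. (\<Sum>b\<in>Basis. ennreal ((b \<bullet> x)\<^sup>2)) \<partial>M)"
    by (simp add: nrm sum_ennreal)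
  also have "\<dots> = (\<Sum>b\<in>Basis. ennreal ((b \<bullet> m)\<^sup>2 + b \<bullet> S b))"
    by (subst nn_integral_sum) (simp_all add: coord)
  also have "\<dots> = ennreal ((norm m)\<^sup>2 + (\<Sum>b\<in>Basis. b \<bullet> S b))"
    using pos by (simp add: nrm sum_ennreal sum.distrib sum_nonneg)
  finally show ?thesis .
qed

text \<open>
  The logarithm of the exponential moment at \<open>u\<close> is a linear form plus a quadratic form in \<open>u\<close>.
  Comparing \<open>u\<close> with \<open>- u\<close> separates the two, and polarization recovers the operator.
\<close>
lemma gaussian_parameters_unique:
  assumes "gaussian m S M" "gaussian n T M"
  shows "m = n" and "S = T"
proof -
  have eq: "u \<bullet> m + (u \<bullet> S u) / 2 = u \<bullet> n + (u \<bullet> T u) / 2" for u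
    using gaussian_exp_moment[OF assms(1), of u] gaussian_exp_moment[OF assms(2), of u] by simp
  have S: "linear S" "\<And>x y. S x \<bullet> y = x \<bullet> S y" and T: "linear T" "\<And>x y. T x \<bullet> y = x \<bullet> T y"
    using assms by (auto simp: gaussian_def covariance_operator_def)
  have 1: "u \<bullet> m = u \<bullet> n \<and> u \<bullet> S u = u \<bullet> T u" for u
    using eq[of u] eq[of "-u"] by (simp add: linear_neg S T)
  then show "m = n" by (metis inner_commute vector_eq_rdot)
  have "x \<bullet> S y = x \<bullet> T y" for x y
  proof -
    have "y \<bullet> S x = x \<bullet> S y" "y \<bullet> T x = x \<bullet> T y" using S T by (metis inner_commute)+
    then show ?thesis
      using 1[of "x + y"] 1[of x] 1[of y] by (simp add: linear_add S T inner_add_left inner_add_right)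
  qed
  then have "S y = T y" for y
    using vector_eq_ldot[of "S y" "T y"] by blast
  then show "S = T" by (rule ext)
qed

section \<open>Mixtures as distributions over Gaussian laws\<close>

text \<open>
  Gaussian laws form a type of their own, so that a mixture is given by a \<open>pmf\<close> over this type and
  \<open>law\<close> is a probability kernel without side conditions.
\<close>
typedef (overloaded) 'a gauss = "{M :: 'a::euclidean_space measure. \<exists>m S. gaussian m S M}"
  morphisms law Gauss
  using gaussian_dirac by blast

text \<open>
  A Gaussian law determines its parameters (\<open>gaussian_parameters_unique\<close>), so the choice in the
  next two definitions is only apparent; see \<open>mean_cov_eqI\<close>.
\<close>
definition mean :: "'a::euclidean_space gauss \<Rightarrow> 'a" where
  "mean g = (SOME m. \<exists>S. gaussian m S (law g))"

definition cov :: "'a::euclidean_space gauss \<Rightarrow> 'a \<Rightarrow> 'a" where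
  "cov g = (SOME S. gaussian (mean g) S (law g))"

lemma gaussian_law: "gaussian (mean g) (cov g) (law g)"
proof -
  have "\<exists>m S. gaussian m S (law g)" using law[of g] by simp
  then have "\<exists>S. gaussian (mean g) S (law g)" unfolding mean_def by (rule someI_ex)
  then show ?thesis unfolding cov_def by (rule someI_ex)
qed

lemma law_Gauss: "gaussian m S M \<Longrightarrow> law (Gauss M) = M"
  by (rule Gauss_inverse) auto

lemma mean_cov_eqI:
  assumes "gaussian m S (law g)" shows "mean g = m" "cov g = S"
  using gaussian_parameters_unique[OF gaussian_law assms] .

lemma gauss_eqI:
  assumes "mean g = mean h" "cov g = cov h"
  shows "g = h"
  using gaussian_eqI[of "mean g" "cov g" "law g" "law h"] gaussian_law[of g] gaussian_law[of h] assms
  by (simp add: law_inject)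

lemma sets_law[simp, measurable_cong]: "sets (law g) = sets borel"
  using gaussian_law[of g] by (simp add: gaussian_def)

lemma space_law[simp]: "space (law g) = UNIV"
  using sets_eq_imp_space_eq[OF sets_law] by simp

lemma prob_space_law: "prob_space (law g)"
  using gaussian_law[of g] by (simp add: gaussian_def)

lemma covariance_operator_cov: "covariance_operator (cov g)"
  using gaussian_law[of g] by (simp add: gaussian_def)

lemma measurable_law: "law \<in> measure_pmf p \<rightarrow>\<^sub>M subprob_algebra borel"
  using prob_space_law by (auto simp: space_subprob_algebra intro: prob_space_imp_subprob_space)

text \<open>
  Meaningful for linear \<open>L\<close>, where the image of a Gaussian law is again Gaussian.
\<close>
definition gimage :: "('a::euclidean_space \<Rightarrow> 'b::euclidean_space) \<Rightarrow> 'a gauss \<Rightarrow> 'b gauss" where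
  "gimage L g = Gauss (distr (law g) borel L)"

lemma law_gimage: "linear L \<Longrightarrow> law (gimage L g) = distr (law g) borel L"
  unfolding gimage_def by (rule law_Gauss gaussian_linear_image gaussian_law)+

lemma mean_gimage: "linear L \<Longrightarrow> mean (gimage L g) = L (mean g)"
  and cov_gimage: "linear L \<Longrightarrow> cov (gimage L g) y = L (cov g (adjoint L y))"
  using mean_cov_eqI[of "L (mean g)" "\<lambda>y. L (cov g (adjoint L y))" "gimage L g"]
    gaussian_linear_image[OF gaussian_law, of L g]
  by (auto simp: law_gimage)

definition mix :: "'a::euclidean_space gauss pmf \<Rightarrow> 'a measure" where
  "mix p = measure_pmf p \<bind> law"

lemma sets_mix[simp, measurable_cong]: "sets (mix p) = sets borel"
  unfolding mix_def by (rule sets_bind) auto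

lemma space_mix[simp]: "space (mix p) = UNIV"
  using sets_eq_imp_space_eq[OF sets_mix] by simp

lemma emeasure_mix:
  "A \<in> sets borel \<Longrightarrow> emeasure (mix p) A = (\<integral>\<^sup>+g. emeasure (law g) A \<partial>measure_pmf p)"
  unfolding mix_def by (rule emeasure_bind[OF _ measurable_law]) auto

lemma nn_integral_mix:
  "f \<in> borel_measurable borel \<Longrightarrow>
    (\<integral>\<^sup>+x. f x \<partial>mix p) = (\<integral>\<^sup>+g. (\<integral>\<^sup>+x. f x \<partial>law g) \<partial>measure_pmf p)"
  unfolding mix_def by (rule nn_integral_bind[OF _ measurable_law])

lemma prob_space_mix:
  fixes p :: "'a::euclidean_space gauss pmf"
  shows "prob_space (mix p)"
proof
  have "emeasure (law g) UNIV = 1" for g :: "'a gauss"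
    using prob_space.emeasure_space_1[OF prob_space_law, of g] by simp
  then show "emeasure (mix p) (space (mix p)) = 1"
    by (simp add: emeasure_mix)
qed

lemma distr_mix:
  assumes "linear L"
  shows "distr (mix p) borel L = mix (map_pmf (gimage L) p)"
proof (rule measure_eqI)
  have [measurable]: "L \<in> borel_measurable borel" using assms by (rule borel_measurable_linear)
  fix A assume "A \<in> sets (distr (mix p) borel L)"
  then have [measurable]: "A \<in> sets borel" by simp
  have "L -` A \<in> sets borel" using measurable_sets[of L borel borel A] by simp
  then show "emeasure (distr (mix p) borel L) A = emeasure (mix (map_pmf (gimage L) p)) A"
    by (simp add: emeasure_distr emeasure_mix law_gimage[OF assms])
qed simp

lemma pmf_of_finite_weights:
  assumes "finite A" "\<And>a. a \<in> A \<Longrightarrow> 0 \<le> f a" "(\<Sum>a\<in>A. f a) = (1::real)"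
  obtains p where "set_pmf p \<subseteq> A" "\<And>a. a \<in> A \<Longrightarrow> pmf p a = f a"
proof -
  define f' where "f' a = (if a \<in> A then f a else 0)" for a
  have nn: "f' a \<ge> 0" for a using assms(2) by (simp add: f'_def)
  have "(\<integral>\<^sup>+a. ennreal (f' a) \<partial>count_space UNIV) = (\<Sum>a\<in>A. ennreal (f' a))"
    by (rule nn_integral_count_space') (auto simp: f'_def assms(1))
  also have "\<dots> = ennreal (\<Sum>a\<in>A. f' a)" using nn by (simp add: sum_ennreal)
  also have "(\<Sum>a\<in>A. f' a) = 1" using assms(3) by (simp add: f'_def)
  finally have 1: "(\<integral>\<^sup>+a. ennreal (f' a) \<partial>count_space UNIV) = 1" by simp
  show ?thesis
    by (rule that[of "embed_pmf f'"])
       (simp_all add: set_embed_pmf[OF nn 1] pmf_embed_pmf[OF nn 1], auto simp: f'_def)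
qed

text \<open>
  Enumerating the support of \<open>p\<close> gives an indexed family of weights and components; conversely an
  indexed family is a distribution on the indices, whose image merges equal components.
\<close>
theorem GMM_infinity_eq: "GMM_infinity = mix ` {p. finite (set_pmf p)}"
proof safe
  fix \<mu> :: "'a measure" assume "\<mu> \<in> GMM_infinity"
  then obtain K where "\<mu> \<in> GMM K" by (auto simp: GMM_infinity_def)
  then obtain w :: "nat \<Rightarrow> real" and m S G where
    sets: "sets \<mu> = sets borel" and w: "\<And>k. k < K \<Longrightarrow> 0 \<le> w k" "(\<Sum>k<K. w k) = 1" and
    G: "\<And>k. k < K \<Longrightarrow> gaussian (m k) (S k) (G k)" and
    em: "\<And>A. A \<in> sets borel \<Longrightarrow> emeasure \<mu> A = (\<Sum>k<K. ennreal (w k) * emeasure (G k) A)"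
    unfolding GMM_def by blast
  obtain q :: "nat pmf" where q: "set_pmf q \<subseteq> {..<K}" "\<And>k. k \<in> {..<K} \<Longrightarrow> pmf q k = w k"
    using pmf_of_finite_weights[of "{..<K}" w] w by auto
  define p where "p = map_pmf (\<lambda>k. Gauss (G k)) q"
  have "\<mu> = mix p"
  proof (rule measure_eqI)
    fix A assume "A \<in> sets \<mu>"
    then have A: "A \<in> sets borel" by (simp add: sets)
    have "emeasure (mix p) A = (\<integral>\<^sup>+k. emeasure (law (Gauss (G k))) A \<partial>measure_pmf q)"
      by (simp add: emeasure_mix[OF A] p_def)
    also have "\<dots> = (\<Sum>k<K. emeasure (law (Gauss (G k))) A * pmf q k)"
      using q by (intro nn_integral_measure_pmf_support) auto
    also have "\<dots> = (\<Sum>k<K. ennreal (w k) * emeasure (G k) A)"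
      using q law_Gauss[OF G] by (intro sum.cong) (auto simp: mult.commute)
    finally show "emeasure \<mu> A = emeasure (mix p) A" using em[OF A] by simp
  qed (simp add: sets)
  moreover have "finite (set_pmf p)"
    using q(1) finite_subset[of "set_pmf q" "{..<K}"] by (simp add: p_def)
  ultimately show "\<mu> \<in> mix ` {p. finite (set_pmf p)}" by blast
next
  fix p :: "'a gauss pmf" assume fin: "finite (set_pmf p)"
  then obtain h where h: "bij_betw h {..<card (set_pmf p)} (set_pmf p)"
    using ex_bij_betw_nat_finite by (metis atLeast0LessThan)
  have "mix p \<in> GMM (card (set_pmf p))"
    unfolding GMM_def
  proof (intro CollectI conjI exI allI impI ballI)
    fix k assume "k < card (set_pmf p)"
    show "0 \<le> pmf p (h k)" by simp
    show "gaussian (mean (h k)) (cov (h k)) (law (h k))" by (rule gaussian_law)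
  next
    show "(\<Sum>k<card (set_pmf p). pmf p (h k)) = 1"
      using sum.reindex_bij_betw[OF h, of "pmf p"] sum_pmf_eq_1[OF fin] by simp
    fix A :: "'a set" assume A: "A \<in> sets borel"
    show "emeasure (mix p) A = (\<Sum>k<card (set_pmf p). ennreal (pmf p (h k)) * emeasure (law (h k)) A)"
      using sum.reindex_bij_betw[OF h, of "\<lambda>g. ennreal (pmf p g) * emeasure (law g) A"]
      by (simp add: emeasure_mix[OF A] nn_integral_measure_pmf_finite[OF fin] mult.commute)
  qed simp
  then show "mix p \<in> GMM_infinity" unfolding GMM_infinity_def by blast
qed

section \<open>Identifiability of finite Gaussian mixtures\<close>

lemma exp_quadratic_tendsto_0:
  fixes a v :: real
  assumes "v < 0 \<or> v = 0 \<and> a < 0"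
  shows "((\<lambda>y. exp (y * a + y\<^sup>2 * v / 2)) \<longlongrightarrow> 0) at_top"
proof -
  have "filterlim (\<lambda>y. y * (a + y * (v / 2))) at_bot at_top"
  proof (cases "v = 0")
    case True
    with assms have "a < 0" by simp
    then show ?thesis
      using filterlim_tendsto_neg_mult_at_bot[OF tendsto_const _ filterlim_ident, of a]
      by (simp add: True mult.commute)
  next
    case False
    with assms have "0 < - v / 2" by simp
    then have "filterlim (\<lambda>y. - a + (- v / 2) * y) at_top at_top"
      by (intro filterlim_tendsto_add_at_top[OF tendsto_const]
          filterlim_tendsto_pos_mult_at_top[OF tendsto_const _ filterlim_ident])
    from filterlim_at_top_mult_at_top[OF filterlim_ident this] show ?thesis
      unfolding filterlim_uminus_at_bot by (simp add: algebra_simps)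
  qed
  then have "((\<lambda>y. exp (y * (a + y * (v / 2)))) \<longlongrightarrow> 0) at_top"
    by (rule filterlim_compose[OF exp_at_bot])
  then show ?thesis by (simp add: algebra_simps power2_eq_square)
qed

text \<open>
  Among the exponents pick the one with lexicographically largest \<open>(v i, a i)\<close>. Dividing the
  relation by the corresponding exponential and letting \<open>y\<close> tend to infinity kills all other
  summands, so its coefficient vanishes; then it is removed and the argument repeated.
\<close>
lemma exp_quadratics_independent:
  fixes a v c :: "'i \<Rightarrow> real"
  assumes "finite I" "inj_on (\<lambda>i. (a i, v i)) I"
    and "\<And>y. (\<Sum>i\<in>I. c i * exp (y * a i + y\<^sup>2 * v i / 2)) = 0"
  shows "\<forall>i\<in>I. c i = 0"
  using assms
proof (induction I rule: finite_psubset_induct)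
  case (psubset I)
  show ?case
  proof (cases "I = {}")
    case False
    define V where "V = Max (v ` I)"
    define J where "J = {i\<in>I. v i = V}"
    define A where "A = Max (a ` J)"
    have "V \<in> v ` I" unfolding V_def using psubset.hyps False by (intro Max_in) auto
    then have "J \<noteq> {}" "finite J" using psubset.hyps by (auto simp: J_def)
    then have "A \<in> a ` J" unfolding A_def by (intro Max_in) auto
    then obtain j where j: "j \<in> I" "v j = V" "a j = A" by (auto simp: J_def)
    have dom: "v i - v j < 0 \<or> v i - v j = 0 \<and> a i - a j < 0" if "i \<in> I - {j}" for i
    proof -
      have "v i \<le> V" unfolding V_def using that psubset.hyps by auto
      moreover have "a i \<le> A" if "v i = V"
        unfolding A_def using \<open>i \<in> I - {j}\<close> that \<open>finite J\<close> by (intro Max_ge) (auto simp: J_def)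
      moreover have "(a i, v i) \<noteq> (a j, v j)"
        using psubset.prems(1) j that by (auto dest: inj_onD)
      ultimately show ?thesis using j by force
    qed
    have "((\<lambda>y. \<Sum>i\<in>I - {j}. c i * exp (y * (a i - a j) + y\<^sup>2 * (v i - v j) / 2)) \<longlongrightarrow> (\<Sum>i\<in>I - {j}. c i * 0)) at_top"
      by (intro tendsto_sum tendsto_mult tendsto_const exp_quadratic_tendsto_0 dom)
    moreover have "(\<Sum>i\<in>I - {j}. c i * exp (y * (a i - a j) + y\<^sup>2 * (v i - v j) / 2)) = - c j" for y
    proof -
      have "exp (- (y * a j + y\<^sup>2 * v j / 2)) * (\<Sum>i\<in>I. c i * exp (y * a i + y\<^sup>2 * v i / 2)) =
        (\<Sum>i\<in>I. c i * exp (y * (a i - a j) + y\<^sup>2 * (v i - v j) / 2))"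
        unfolding sum_distrib_left
      proof (intro sum.cong refl)
        fix i
        have "exp (y * (a i - a j) + y\<^sup>2 * (v i - v j) / 2) =
          exp (- (y * a j + y\<^sup>2 * v j / 2)) * exp (y * a i + y\<^sup>2 * v i / 2)"
          unfolding exp_add[symmetric] by (simp add: algebra_simps diff_divide_distrib)
        then show "exp (- (y * a j + y\<^sup>2 * v j / 2)) * (c i * exp (y * a i + y\<^sup>2 * v i / 2)) =
          c i * exp (y * (a i - a j) + y\<^sup>2 * (v i - v j) / 2)" by simp
      qed
      then have "(\<Sum>i\<in>I. c i * exp (y * (a i - a j) + y\<^sup>2 * (v i - v j) / 2)) = 0"
        using psubset.prems(2)[of y] by simp
      then show ?thesis
        using psubset.hyps j by (simp add: sum.remove)
    qed
    ultimately have "c j = 0" by (simp add: tendsto_const_iff)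
    moreover have "\<forall>i\<in>I - {j}. c i = 0"
    proof (rule psubset.IH)
      show "I - {j} \<subset> I" using j by blast
      show "inj_on (\<lambda>i. (a i, v i)) (I - {j})" using psubset.prems(1) by (rule inj_on_diff)
      show "(\<Sum>i\<in>I - {j}. c i * exp (y * a i + y\<^sup>2 * v i / 2)) = 0" for y
        using psubset.prems(2)[of y] psubset.hyps j \<open>c j = 0\<close> by (simp add: sum.remove)
    qed
    ultimately show ?thesis by blast
  qed simp
qed

text \<open>
  A point where all functions of \<open>I\<close> are nonzero is joined by a line to a point where the new
  function is nonzero. On this line every function is a polynomial that does not vanish
  identically, and finitely many such polynomials have only finitely many roots.
\<close>
lemma common_nonzero_point:
  fixes f :: "'i \<Rightarrow> 'a::real_vector \<Rightarrow> real"
  assumes "finite I"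
    and "\<And>i u v. i \<in> I \<Longrightarrow> \<exists>p. \<forall>s. f i (u + s *\<^sub>R v) = poly p s"
    and "\<And>i. i \<in> I \<Longrightarrow> \<exists>u. f i u \<noteq> 0"
  shows "\<exists>u. \<forall>i\<in>I. f i u \<noteq> 0"
  using assms
proof (induction I rule: finite_induct)
  case (insert j I)
  then obtain u where u: "\<forall>i\<in>I. f i u \<noteq> 0" by auto
  obtain w where w: "f j w \<noteq> 0" using insert.prems(2)[of j] by auto
  have "\<forall>i\<in>insert j I. \<exists>p. \<forall>s. f i (u + s *\<^sub>R (w - u)) = poly p s" using insert.prems(1) by blast
  then obtain p where p: "\<And>i s. i \<in> insert j I \<Longrightarrow> f i (u + s *\<^sub>R (w - u)) = poly (p i) s"
    by metis
  have "p i \<noteq> 0" if i: "i \<in> insert j I" for i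
  proof
    assume "p i = 0"
    then have "f i (u + s *\<^sub>R (w - u)) = 0" for s using p[OF i] by simp
    from this[of 0] this[of 1] show False using i u w by auto
  qed
  then have "finite (\<Union>i\<in>insert j I. {s. poly (p i) s = 0})"
    using insert.hyps by (auto intro: poly_roots_finite)
  then obtain s where "s \<notin> (\<Union>i\<in>insert j I. {s. poly (p i) s = 0})"
    using ex_new_if_finite infinite_UNIV_char_0 by blast
  then have "\<forall>i\<in>insert j I. f i (u + s *\<^sub>R (w - u)) \<noteq> 0" using p by auto
  then show ?case by blast
qed simp

text \<open>
  The condition \<open>f (g, h) u \<noteq> 0\<close>, with \<open>f\<close> a sum of two squares, says that \<open>u\<close> separates the
  parameters of \<open>g\<close> and \<open>h\<close>. Some \<open>u\<close> separates each pair, since otherwise \<open>g\<close> and \<open>h\<close> would have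
  the same characteristic function; one \<open>u\<close> separates all pairs because \<open>f\<close> is polynomial along lines.
\<close>
lemma separating_direction:
  fixes F :: "'a::euclidean_space gauss set"
  assumes "finite F"
  shows "\<exists>u. inj_on (\<lambda>g. (u \<bullet> mean g, u \<bullet> cov g u)) F"
proof -
  define f :: "'a gauss \<times> 'a gauss \<Rightarrow> 'a \<Rightarrow> real"
    where "f = (\<lambda>(g, h) u. (u \<bullet> (mean g - mean h))\<^sup>2 + (u \<bullet> cov g u - u \<bullet> cov h u)\<^sup>2)"
  have "\<exists>u. \<forall>i\<in>{(g, h) \<in> F \<times> F. g \<noteq> h}. f i u \<noteq> 0"
  proof (rule common_nonzero_point)
    show "finite {(g, h) \<in> F \<times> F. g \<noteq> h}"
      by (rule finite_subset[of _ "F \<times> F"]) (use assms in auto)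
    fix i assume "i \<in> {(g, h) \<in> F \<times> F. g \<noteq> h}"
    then obtain g h where i: "i = (g, h)" "g \<noteq> h" by auto
    show "\<exists>p. \<forall>s. f i (u + s *\<^sub>R v) = poly p s" for u v
    proof -
      have q: "\<exists>p. \<forall>s. (u + s *\<^sub>R v) \<bullet> cov g (u + s *\<^sub>R v) = poly p s" for g
      proof (intro exI allI)
        fix s
        have "linear (cov g)" using covariance_operator_cov[of g] by (simp add: covariance_operator_def)
        then show "(u + s *\<^sub>R v) \<bullet> cov g (u + s *\<^sub>R v) =
          poly [: u \<bullet> cov g u, u \<bullet> cov g v + v \<bullet> cov g u, v \<bullet> cov g v :] s"
          by (simp add: linear_add linear_scale inner_add_left inner_add_right algebra_simps)
      qed
      obtain p1 p2 where p: "\<And>s. (u + s *\<^sub>R v) \<bullet> cov g (u + s *\<^sub>R v) = poly p1 s"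
        "\<And>s. (u + s *\<^sub>R v) \<bullet> cov h (u + s *\<^sub>R v) = poly p2 s"
        using q[of g] q[of h] by blast
      have "f i (u + s *\<^sub>R v) =
        poly ([: u \<bullet> (mean g - mean h), v \<bullet> (mean g - mean h) :]\<^sup>2 + (p1 - p2)\<^sup>2) s" for s
        by (simp only: f_def i prod.case p) (simp add: poly_power inner_add_left)
      then show ?thesis by blast
    qed
    show "\<exists>u. f i u \<noteq> 0"
    proof (rule ccontr)
      assume "\<not> (\<exists>u. f i u \<noteq> 0)"
      then have eq: "u \<bullet> mean g = u \<bullet> mean h" "u \<bullet> cov g u = u \<bullet> cov h u" for u
        by (auto simp: f_def i sum_power2_eq_zero_iff inner_diff_right)
      have "law g = law h"
        by (rule measure_eqI_characteristic)
           (use gaussian_law[of g] gaussian_law[of h] in \<open>auto simp: gaussian_def eq\<close>)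
      then show False using i by (simp add: law_inject)
    qed
  qed
  then obtain u where "\<And>g h. g \<in> F \<Longrightarrow> h \<in> F \<Longrightarrow> g \<noteq> h \<Longrightarrow> f (g, h) u \<noteq> 0" by auto
  then have "inj_on (\<lambda>g. (u \<bullet> mean g, u \<bullet> cov g u)) F"
    unfolding f_def by (intro inj_onI) (fastforce simp: inner_diff_right)
  then show ?thesis by blast
qed

text \<open>
  Identifiability of finite Gaussian mixtures. Along a separating direction \<open>u\<close> the exponential
  moments of the components are exponentials of distinct quadratic polynomials, hence linearly
  independent, so equal mixtures have equal weights.
\<close>
theorem mix_inject:
  assumes "finite (set_pmf p)" "finite (set_pmf q)" "mix p = mix q"
  shows "p = q"
proof -
  define F where "F = set_pmf p \<union> set_pmf q"
  have F: "finite F" using assms by (simp add: F_def)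
  obtain u where inj: "inj_on (\<lambda>g. (u \<bullet> mean g, u \<bullet> cov g u)) F"
    using separating_direction[OF F] by blast
  define e where "e g y = exp (y * (u \<bullet> mean g) + y\<^sup>2 * (u \<bullet> cov g u) / 2)" for g y
  have lap: "(\<integral>\<^sup>+x. ennreal (exp ((y *\<^sub>R u) \<bullet> x)) \<partial>mix r) = ennreal (\<Sum>g\<in>F. pmf r g * e g y)"
    if "set_pmf r \<subseteq> F" for r y
  proof -
    have "(\<integral>\<^sup>+x. ennreal (exp ((y *\<^sub>R u) \<bullet> x)) \<partial>law g) = ennreal (e g y)" for g
    proof -
      have "linear (cov g)" using covariance_operator_cov[of g] by (simp add: covariance_operator_def)
      then show ?thesis
        unfolding gaussian_exp_moment[OF gaussian_law] e_def
        by (simp add: linear_scale power2_eq_square mult.assoc)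
    qed
    then have "(\<integral>\<^sup>+x. ennreal (exp ((y *\<^sub>R u) \<bullet> x)) \<partial>mix r) = (\<integral>\<^sup>+g. ennreal (e g y) \<partial>measure_pmf r)"
      by (simp add: nn_integral_mix)
    also have "\<dots> = (\<Sum>g\<in>F. ennreal (e g y) * pmf r g)"
      using F that by (intro nn_integral_measure_pmf_support) auto
    also have "\<dots> = ennreal (\<Sum>g\<in>F. pmf r g * e g y)"
      by (simp add: e_def ennreal_mult'[symmetric] sum_ennreal mult.commute)
    finally show ?thesis .
  qed
  have "(\<Sum>g\<in>F. (pmf p g - pmf q g) * exp (y * (u \<bullet> mean g) + y\<^sup>2 * (u \<bullet> cov g u) / 2)) = 0" for y
  proof -
    have "(\<Sum>g\<in>F. pmf p g * e g y) = (\<Sum>g\<in>F. pmf q g * e g y)"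
      using lap[of p y] lap[of q y] assms(3)
      by (simp add: F_def e_def sum_nonneg)
    then show ?thesis by (simp add: e_def[symmetric] left_diff_distrib sum_subtractf)
  qed
  from exp_quadratics_independent[OF F inj this] have "pmf p g = pmf q g" if "g \<in> F" for g
    using that by auto
  moreover have "pmf p g = pmf q g" if "g \<notin> F" for g
    using that by (simp add: F_def set_pmf_iff)
  ultimately show ?thesis by (intro pmf_eqI) blast
qed

section \<open>Couplings and their composition\<close>

lemma linear_fst_proj: "linear (fst :: 'a::real_vector \<times> 'b::real_vector \<Rightarrow> 'a)"
  and linear_snd_proj: "linear (snd :: 'a \<times> 'b \<Rightarrow> 'b)"
  by (auto simp: linear_iff)

lemma gimage_gimage:
  assumes "linear L" "linear K"
  shows "gimage L (gimage K g) = gimage (\<lambda>x. L (K x)) g"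
proof -
  note [measurable] = borel_measurable_linear[OF assms(1)] borel_measurable_linear[OF assms(2)]
  have "linear (\<lambda>x. L (K x))" using linear_compose[OF assms(2,1)] by (simp add: o_def)
  then have "law (gimage L (gimage K g)) = law (gimage (\<lambda>x. L (K x)) g)"
    by (simp add: law_gimage assms distr_distr o_def)
  then show ?thesis by (simp add: law_inject)
qed

lemma borel_measurable_dist_sq:
  fixes f g :: "'a::euclidean_space \<Rightarrow> 'b::euclidean_space"
  assumes "sets M = sets borel" "linear f" "linear g"
  shows "(\<lambda>x. ennreal ((norm (f x - g x))\<^sup>2)) \<in> borel_measurable M"
proof -
  note [measurable] = borel_measurable_linear[OF assms(2)] borel_measurable_linear[OF assms(3)]
  note [measurable_cong] = assms(1)
  show ?thesis by measurable
qed

lemma adjoint_fst: "adjoint (fst :: 'a::euclidean_space \<times> 'b::euclidean_space \<Rightarrow> 'a) = (\<lambda>x. (x, 0))"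
  and adjoint_snd: "adjoint (snd :: 'a::euclidean_space \<times> 'b::euclidean_space \<Rightarrow> 'b) = (\<lambda>y. (0, y))"
  by (rule adjoint_unique; auto simp: inner_prod_def)+

abbreviation fstG :: "('a::euclidean_space \<times> 'b::euclidean_space) gauss \<Rightarrow> 'a gauss" where
  "fstG \<equiv> gimage fst"

abbreviation sndG :: "('a::euclidean_space \<times> 'b::euclidean_space) gauss \<Rightarrow> 'b gauss" where
  "sndG \<equiv> gimage snd"

lemma mean_fstG: "mean (fstG P) = fst (mean P)"
  and mean_sndG: "mean (sndG P) = snd (mean P)"
  and cov_fstG: "cov (fstG P) x = fst (cov P (x, 0))"
  and cov_sndG: "cov (sndG P) y = snd (cov P (0, y))"
  by (simp_all add: mean_gimage cov_gimage linear_fst_proj linear_snd_proj adjoint_fst adjoint_snd)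

lemma linear_cov: "linear (cov g)"
  and cov_symmetric: "cov g x \<bullet> y = x \<bullet> cov g y"
  and cov_nonneg: "0 \<le> x \<bullet> cov g x"
  using covariance_operator_cov[of g] by (auto simp: covariance_operator_def)

definition pairG :: "'a::euclidean_space gauss \<Rightarrow> 'b::euclidean_space gauss \<Rightarrow> ('a \<times> 'b) gauss" where
  "pairG g h = Gauss (law g \<Otimes>\<^sub>M law h)"

lemma mean_pairG: "mean (pairG g h) = (mean g, mean h)"
  and cov_pairG: "cov (pairG g h) z = (cov g (fst z), cov h (snd z))"
proof -
  have "gaussian (mean g, mean h) (\<lambda>z. (cov g (fst z), cov h (snd z))) (law (pairG g h))"
    using gaussian_pair[OF gaussian_law gaussian_law, of g h] by (simp add: pairG_def law_Gauss)
  from mean_cov_eqI[OF this] show "mean (pairG g h) = (mean g, mean h)"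
    "cov (pairG g h) z = (cov g (fst z), cov h (snd z))" by auto
qed

lemma fstG_pairG: "fstG (pairG g h) = g" and sndG_pairG: "sndG (pairG g h) = h"
  by (auto intro!: gauss_eqI ext simp: mean_fstG mean_sndG cov_fstG cov_sndG mean_pairG cov_pairG)

definition transport_cost :: "('a::euclidean_space \<times> 'a) measure \<Rightarrow> ennreal" where
  "transport_cost \<gamma> = (\<integral>\<^sup>+z. ennreal ((norm (fst z - snd z))\<^sup>2) \<partial>\<gamma>)"

text \<open>
  The cost is the second moment of the Gaussian vector \<open>x - y\<close>. For fixed marginals the means are
  fixed, so it depends on the coupling only through the second summand, which is linear in the
  covariance.
\<close>
lemma transport_cost_law:
  fixes P :: "('a::euclidean_space \<times> 'a) gauss"
  shows "transport_cost (law P) = ennreal ((norm (fst (mean P) - snd (mean P)))\<^sup>2 +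
     (\<Sum>b\<in>Basis. (b, - b) \<bullet> cov P (b, - b)))"
proof -
  define L where "L = (\<lambda>z::'a\<times>'a. fst z - snd z)"
  have lin: "linear L" by (auto simp: L_def linear_iff algebra_simps)
  note [measurable] = borel_measurable_linear[OF lin]
  have adj: "adjoint L = (\<lambda>b. (b, - b))"
    by (rule adjoint_unique) (auto simp: L_def inner_prod_def algebra_simps)
  have inn: "b \<bullet> L z = (b, - b) \<bullet> z" for b z
    by (simp add: L_def inner_prod_def algebra_simps)
  have "transport_cost (law P) = (\<integral>\<^sup>+x. ennreal ((norm x)\<^sup>2) \<partial>law (gimage L P))"
    unfolding transport_cost_def law_gimage[OF lin] by (subst nn_integral_distr) (auto, simp add: L_def)
  also have "\<dots> = ennreal ((norm (L (mean P)))\<^sup>2 + (\<Sum>b\<in>Basis. b \<bullet> L (cov P (b, - b))))"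
    unfolding gaussian_second_moment[OF gaussian_law] by (simp add: mean_gimage[OF lin] cov_gimage[OF lin] adj)
  finally show ?thesis unfolding inn by (simp add: L_def)
qed

lemma transport_cost_law_finite: "transport_cost (law P) < \<top>"
  by (simp add: transport_cost_law)

lemma transport_cost_mix:
  "transport_cost (mix r) = (\<integral>\<^sup>+P. transport_cost (law P) \<partial>measure_pmf r)"
  unfolding transport_cost_def
  by (rule nn_integral_mix borel_measurable_dist_sq linear_fst_proj linear_snd_proj refl)+

text \<open>
  The marginals of \<open>mix r\<close> are the mixtures over the marginals of the components; identifiability
  turns equality of these mixtures into equality of distributions over Gaussian laws.
\<close>
lemma GMM_couplings_eq:
  fixes p q :: "'a::euclidean_space gauss pmf"
  assumes "finite (set_pmf p)" "finite (set_pmf q)"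
  shows "couplings (mix p) (mix q) \<inter> GMM_infinity =
    mix ` {r. finite (set_pmf r) \<and> map_pmf fstG r = p \<and> map_pmf sndG r = q}"
proof -
  have "mix r \<in> couplings (mix p) (mix q) \<longleftrightarrow> map_pmf fstG r = p \<and> map_pmf sndG r = q"
    if "finite (set_pmf r)" for r
    using assms that mix_inject[of "map_pmf fstG r" p] mix_inject[of "map_pmf sndG r" q]
    by (auto simp: couplings_def prob_space_mix distr_mix linear_fst_proj linear_snd_proj)
  then show ?thesis unfolding GMM_infinity_eq by auto
qed

text \<open>
  If \<open>T\<close> is the covariance of \<open>(Y, Z)\<close>, then \<open>- L\<close> is the adjoint of a matrix of linear regression of
  \<open>Z\<close> on \<open>Y\<close>. Solving for \<open>L t\<close> requires that the cross-covariance \<open>C\<close> takes values in the range of the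
  covariance \<open>S\<close> of \<open>Y\<close>, which may be singular. The component \<open>z\<close> of \<open>C t\<close> orthogonal to that range has
  \<open>z \<bullet> S z = 0\<close>; hence \<open>T (z, 0) = 0\<close>, and \<open>z\<close> is orthogonal to \<open>C t\<close> itself.
\<close>
lemma covariance_regression:
  fixes T :: "'a::euclidean_space \<times> 'b::euclidean_space \<Rightarrow> 'a \<times> 'b"
  assumes "covariance_operator T"
  obtains L :: "'b \<Rightarrow> 'a" where "linear L" "\<And>t. fst (T (L t, t)) = 0"
proof -
  have lin: "linear T" and sym: "\<And>x y. T x \<bullet> y = x \<bullet> T y"
    using assms by (auto simp: covariance_operator_def)
  define S where "S y = fst (T (y, 0))" for y
  define C where "C t = fst (T (0, t))" for t
  have linS: "linear S" and linC: "linear C"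
    using linear_add[OF lin, of "(_, 0)" "(_, 0)"] linear_add[OF lin, of "(0, _)" "(0, _)"]
      linear_scale[OF lin, of _ "(_, 0)"] linear_scale[OF lin, of _ "(0, _)"]
    by (auto simp: S_def C_def linear_iff)
  have range: "C t \<in> range S" for t
  proof -
    obtain y z where yz: "y \<in> span (range S)" "\<And>w. w \<in> span (range S) \<Longrightarrow> orthogonal z w" "C t = y + z"
      using orthogonal_subspace_decomp_exists[of "range S" "C t"] by metis
    have "(z, 0) \<bullet> T (z, 0) = z \<bullet> S z" by (simp add: inner_prod_def S_def)
    also have "\<dots> = 0" using yz(2)[of "S z"] by (simp add: orthogonal_def span_base)
    finally have "T (z, 0) = 0" using covariance_operator_null[OF assms] by blast
    then have "z \<bullet> C t = 0"
      using sym[of "(z, 0)" "(0, t)"] by (simp add: C_def inner_prod_def)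
    moreover have "z \<bullet> y = 0" using yz by (simp add: orthogonal_def)
    ultimately have "z = 0" using yz(3) by (simp add: inner_add_right)
    then show ?thesis
      using yz linear_span_image[OF linS, of UNIV] by simp
  qed
  obtain h where h: "linear h" "\<And>v. v \<in> range S \<Longrightarrow> S (h v) = v"
    using linear_exists_right_inverse_on[OF linS subspace_UNIV] by blast
  define L where "L t = - h (C t)" for t
  have linL: "linear L"
    unfolding L_def using linear_compose_neg[OF linear_compose[OF linC h(1)]] by (simp add: o_def)
  have "fst (T (L t, t)) = 0" for t
  proof -
    have "T (L t, t) = T (L t, 0) + T (0, t)" using linear_add[OF lin, of "(L t, 0)" "(0, t)"] by simp
    then have "fst (T (L t, t)) = S (L t) + C t" by (simp add: S_def C_def)
    then show ?thesis using h(2)[OF range] by (simp add: L_def linear_neg[OF linS])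
  qed
  with linL show thesis by (rule that)
qed

text \<open>
  Take \<open>(X, Y)\<close> with law \<open>P\<close> and an independent \<open>(Y', Z)\<close> with law \<open>Q\<close>. With \<open>L\<close> from the regression of
  \<open>Z\<close> on \<open>Y'\<close> and \<open>B\<close> its adjoint, the residual \<open>Z + B Y'\<close> is uncorrelated with \<open>Y'\<close>, hence
  \<open>(Y, (Z + B Y') - B Y)\<close> has the same mean and covariance as \<open>(Y', Z)\<close>, and so has law \<open>Q\<close>. The triple
  \<open>(X, Y, Z + B Y' - B Y)\<close> is a linear image of a product of Gaussian laws and therefore Gaussian.
\<close>
theorem gaussian_gluing:
  fixes P :: "('a::euclidean_space \<times> 'b::euclidean_space) gauss" and Q :: "('b \<times> 'c::euclidean_space) gauss"
  assumes "sndG P = fstG Q"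
  obtains H :: "('a \<times> 'b \<times> 'c) gauss"
  where "gimage (\<lambda>w. (fst w, fst (snd w))) H = P" "sndG H = Q"
proof -
  obtain L :: "'c \<Rightarrow> 'b" where L: "linear L" "\<And>t. fst (cov Q (L t, t)) = 0"
    using covariance_regression[OF covariance_operator_cov] by blast
  define B where "B = adjoint L"
  have B: "linear B" and adjB: "\<And>x t. B x \<bullet> t = x \<bullet> L t"
    using adjoint_linear[OF L(1)] adjoint_works[OF L(1)] by (auto simp: B_def inner_commute)
  define \<Lambda> :: "('a \<times> 'b) \<times> ('b \<times> 'c) \<Rightarrow> 'a \<times> 'b \<times> 'c"
    where "\<Lambda> w = (fst (fst w), snd (fst w), snd (snd w) + B (fst (snd w)) - B (snd (fst w)))" for w
  have lin\<Lambda>: "linear \<Lambda>" using B by (auto simp: \<Lambda>_def linear_iff algebra_simps)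
  define H where "H = gimage \<Lambda> (pairG P Q)"
  have lin12: "linear (\<lambda>w::'a \<times> 'b \<times> 'c. (fst w, fst (snd w)))" by (auto simp: linear_iff)
  have "gimage (\<lambda>w. (fst w, fst (snd w))) H = fstG (pairG P Q)"
    unfolding H_def gimage_gimage[OF lin12 lin\<Lambda>] by (simp add: \<Lambda>_def)
  then have 1: "gimage (\<lambda>w. (fst w, fst (snd w))) H = P" by (simp add: fstG_pairG)
  define K :: "('a \<times> 'b) \<times> ('b \<times> 'c) \<Rightarrow> 'b \<times> 'c" where "K w = snd (\<Lambda> w)" for w
  have linK: "linear K" unfolding K_def using linear_compose[OF lin\<Lambda> linear_snd_proj] by (simp add: o_def)
  have sndH: "sndG H = gimage K (pairG P Q)"
    unfolding H_def gimage_gimage[OF linear_snd_proj lin\<Lambda>] K_def ..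
  have adjK: "adjoint K = (\<lambda>z. ((0, fst z - L (snd z)), (L (snd z), snd z)))"
    by (rule adjoint_unique)
       (auto simp: K_def \<Lambda>_def inner_prod_def adjB inner_add_left inner_diff_left inner_diff_right)
  have "mean (gimage K (pairG P Q)) = mean Q"
    using arg_cong[OF assms, of mean]
    by (simp add: mean_gimage[OF linK] mean_pairG mean_fstG mean_sndG K_def \<Lambda>_def prod_eq_iff)
  moreover have "cov (gimage K (pairG P Q)) z = cov Q z" for z
  proof -
    obtain s t where z: "z = (s, t)" by fastforce
    \<comment> \<open>The decomposition \<open>(s, t) = (r, 0) + (L t, t)\<close> splits the vector into its parts along \<open>Y\<close> and the residual.\<close>
    define r where "r = s - L t"
    have S: "snd (cov P (0, r)) = fst (cov Q (r, 0))"
      using arg_cong[OF assms, of cov] by (metis cov_fstG cov_sndG)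
    \<comment> \<open>The vectors \<open>(r, 0)\<close> and \<open>(L t, t)\<close> are orthogonal for the form \<open>cov Q\<close>, for every \<open>t\<close>.\<close>
    have cross: "snd (cov Q (r, 0)) = - B (fst (cov Q (r, 0)))"
    proof -
      have "snd (cov Q (r, 0)) \<bullet> t = - B (fst (cov Q (r, 0))) \<bullet> t" for t
      proof -
        have "snd (cov Q (r, 0)) \<bullet> t = cov Q (r, 0) \<bullet> (L t, t) - fst (cov Q (r, 0)) \<bullet> L t"
          by (simp add: inner_prod_def)
        also have "cov Q (r, 0) \<bullet> (L t, t) = 0"
          unfolding cov_symmetric by (simp add: inner_prod_def L(2))
        finally show ?thesis by (simp add: adjB)
      qed
      then show ?thesis using vector_eq_rdot by blast
    qed
    have "cov Q z = cov Q ((r, 0) + (L t, t))" by (simp add: z r_def)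
    also have "\<dots> = cov Q (r, 0) + cov Q (L t, t)" by (rule linear_add[OF linear_cov])
    finally have "cov Q z = cov Q (r, 0) + cov Q (L t, t)" .
    then show ?thesis
      by (simp add: cov_gimage[OF linK] cov_pairG adjK z r_def[symmetric] K_def \<Lambda>_def L(2) S cross prod_eq_iff linear_0[OF B])
  qed
  ultimately have "sndG H = Q" unfolding sndH by (intro gauss_eqI ext)
  with 1 show thesis by (rule that)
qed

text \<open>
  The triangle inequality in a form that is linear in the squared distances: the minimum of
  \<open>a\<^sup>2 / \<theta> + b\<^sup>2 / (1 - \<theta>)\<close> over \<open>\<theta>\<close> is \<open>(a + b)\<^sup>2\<close>. It can be integrated for fixed \<open>\<theta>\<close>, first over a
  Gaussian law and then over a mixture, and optimising over \<open>\<theta>\<close> at the very end takes the place of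
  Minkowski's inequality.
\<close>
lemma norm_diff_sq_split:
  fixes x y z :: "'a::real_inner"
  assumes "0 < \<theta>" "\<theta> < 1"
  shows "(norm (x - z))\<^sup>2 \<le> (norm (x - y))\<^sup>2 / \<theta> + (norm (y - z))\<^sup>2 / (1 - \<theta>)"
proof -
  define a b where "a = norm (x - y)" and "b = norm (y - z)"
  have "norm (x - z) \<le> a + b" unfolding a_def b_def using norm_triangle_ineq[of "x - y" "y - z"] by simp
  then have "(norm (x - z))\<^sup>2 \<le> (a + b)\<^sup>2" by (intro power_mono) auto
  also have "(a + b)\<^sup>2 \<le> a\<^sup>2 / \<theta> + b\<^sup>2 / (1 - \<theta>)"
  proof -
    have "a\<^sup>2 / \<theta> + b\<^sup>2 / (1 - \<theta>) - (a + b)\<^sup>2 = ((1 - \<theta>) * a - \<theta> * b)\<^sup>2 / (\<theta> * (1 - \<theta>))"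
      using assms by (simp add: field_simps power2_eq_square)
    also have "\<dots> \<ge> 0" using assms by simp
    finally show ?thesis by simp
  qed
  finally show ?thesis by (simp add: a_def b_def)
qed

lemma gaussian_coupling_composition:
  fixes P Q :: "('a::euclidean_space \<times> 'a) gauss"
  assumes "sndG P = fstG Q"
  shows "\<exists>R. fstG R = fstG P \<and> sndG R = sndG Q \<and>
    (\<forall>\<theta>. 0 < \<theta> \<longrightarrow> \<theta> < 1 \<longrightarrow> transport_cost (law R) \<le>
       ennreal (1 / \<theta>) * transport_cost (law P) + ennreal (1 / (1 - \<theta>)) * transport_cost (law Q))"
proof -
  obtain H :: "('a \<times> 'a \<times> 'a) gauss"
    where P: "gimage (\<lambda>w. (fst w, fst (snd w))) H = P" and Q: "sndG H = Q"
    using gaussian_gluing[OF assms] .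
  have lin: "linear (\<lambda>w::'a \<times> 'a \<times> 'a. (fst w, fst (snd w)))" "linear (\<lambda>w::'a \<times> 'a \<times> 'a. (fst w, snd (snd w)))"
    by (auto simp: linear_iff)
  define R where "R = gimage (\<lambda>w. (fst w, snd (snd w))) H"
  have "fstG R = fstG P" "sndG R = sndG Q"
    unfolding R_def P[symmetric] Q[symmetric]
    by (simp_all add: gimage_gimage lin linear_fst_proj linear_snd_proj)
  moreover have "transport_cost (law R) \<le>
    ennreal (1 / \<theta>) * transport_cost (law P) + ennreal (1 / (1 - \<theta>)) * transport_cost (law Q)"
    if "0 < \<theta>" "\<theta> < 1" for \<theta>
  proof -
    have lin3: "linear (\<lambda>w::'a \<times> 'a \<times> 'a. fst (snd w))" "linear (\<lambda>w::'a \<times> 'a \<times> 'a. snd (snd w))"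
      by (auto simp: linear_iff)
    note meas = borel_measurable_dist_sq[OF sets_law linear_fst_proj lin3(1)]
      borel_measurable_dist_sq[OF sets_law lin3]
    have push: "transport_cost (distr (law H) borel K) = (\<integral>\<^sup>+w. ennreal ((norm (fst (K w) - snd (K w)))\<^sup>2) \<partial>law H)"
      if "linear K" for K :: "'a \<times> 'a \<times> 'a \<Rightarrow> 'a \<times> 'a"
      unfolding transport_cost_def
      using borel_measurable_linear[OF that]
      by (intro nn_integral_distr borel_measurable_dist_sq linear_fst_proj linear_snd_proj) simp_all
    have "transport_cost (law R) = (\<integral>\<^sup>+w. ennreal ((norm (fst w - snd (snd w)))\<^sup>2) \<partial>law H)"
      unfolding R_def law_gimage[OF lin(2)] by (simp add: push[OF lin(2)])
    also have "\<dots> \<le> (\<integral>\<^sup>+w. ennreal (1 / \<theta>) * ennreal ((norm (fst w - fst (snd w)))\<^sup>2) +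
        ennreal (1 / (1 - \<theta>)) * ennreal ((norm (fst (snd w) - snd (snd w)))\<^sup>2) \<partial>law H)"
      using that norm_diff_sq_split[OF that]
      by (intro nn_integral_mono)
         (simp add: ennreal_mult'[symmetric] ennreal_plus[symmetric] del: ennreal_plus)
    also have "\<dots> = ennreal (1 / \<theta>) * (\<integral>\<^sup>+w. ennreal ((norm (fst w - fst (snd w)))\<^sup>2) \<partial>law H) +
        ennreal (1 / (1 - \<theta>)) * (\<integral>\<^sup>+w. ennreal ((norm (fst (snd w) - snd (snd w)))\<^sup>2) \<partial>law H)"
      using meas by (subst nn_integral_add) (auto simp: nn_integral_cmult)
    also have "(\<integral>\<^sup>+w. ennreal ((norm (fst w - fst (snd w)))\<^sup>2) \<partial>law H) = transport_cost (law P)"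
      unfolding P[symmetric] law_gimage[OF lin(1)] by (simp add: push[OF lin(1)])
    also have "(\<integral>\<^sup>+w. ennreal ((norm (fst (snd w) - snd (snd w)))\<^sup>2) \<partial>law H) = transport_cost (law Q)"
      unfolding Q[symmetric] law_gimage[OF linear_snd_proj] by (simp add: push[OF linear_snd_proj])
    finally show ?thesis .
  qed
  ultimately show ?thesis by blast
qed

text \<open>
  Since the middle marginals agree as distributions over Gaussian laws, the components of \<open>r\<close> and \<open>s\<close>
  can be paired so that the middle marginals of each pair agree; then every pair is composed.
\<close>
theorem mixture_coupling_composition:
  fixes r s :: "('a::euclidean_space \<times> 'a) gauss pmf"
  assumes fin: "finite (set_pmf r)" "finite (set_pmf s)"
    and eq: "map_pmf sndG r = map_pmf fstG s"
  obtains u where "finite (set_pmf u)" "map_pmf fstG u = map_pmf fstG r" "map_pmf sndG u = map_pmf sndG s"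
    "\<And>\<theta>. 0 < \<theta> \<Longrightarrow> \<theta> < 1 \<Longrightarrow> transport_cost (mix u) \<le>
       ennreal (1 / \<theta>) * transport_cost (mix r) + ennreal (1 / (1 - \<theta>)) * transport_cost (mix s)"
proof -
  \<comment> \<open>Two image distributions agree iff the originals have a coupling supported on pairs with equal images.\<close>
  have "rel_pmf (\<lambda>P Q. sndG P = fstG Q) r s"
  proof -
    have "rel_pmf (=) (map_pmf sndG r) (map_pmf fstG s)" unfolding eq pmf.rel_eq ..
    then show ?thesis unfolding pmf.rel_map .
  qed
  then obtain j where j: "\<And>P Q. (P, Q) \<in> set_pmf j \<Longrightarrow> sndG P = fstG Q"
    and r: "map_pmf fst j = r" and s: "map_pmf snd j = s"
    by (cases rule: rel_pmf.cases) blast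
  have "\<exists>G. \<forall>P Q. sndG P = fstG Q \<longrightarrow> fstG (G P Q) = fstG P \<and> sndG (G P Q) = sndG Q \<and>
    (\<forall>\<theta>. 0 < \<theta> \<longrightarrow> \<theta> < 1 \<longrightarrow> transport_cost (law (G P Q)) \<le>
       ennreal (1 / \<theta>) * transport_cost (law P) + ennreal (1 / (1 - \<theta>)) * transport_cost (law Q))"
    using gaussian_coupling_composition by metis
  then obtain G :: "('a \<times> 'a) gauss \<Rightarrow> ('a \<times> 'a) gauss \<Rightarrow> ('a \<times> 'a) gauss" where
    G: "\<And>P Q. sndG P = fstG Q \<Longrightarrow> fstG (G P Q) = fstG P"
    "\<And>P Q. sndG P = fstG Q \<Longrightarrow> sndG (G P Q) = sndG Q"
    "\<And>P Q \<theta>. sndG P = fstG Q \<Longrightarrow> 0 < \<theta> \<Longrightarrow> \<theta> < 1 \<Longrightarrow> transport_cost (law (G P Q)) \<le>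
       ennreal (1 / \<theta>) * transport_cost (law P) + ennreal (1 / (1 - \<theta>)) * transport_cost (law Q)"
    by blast
  define u where "u = map_pmf (\<lambda>(P, Q). G P Q) j"
  show thesis
  proof (rule that)
    have "set_pmf j \<subseteq> set_pmf r \<times> set_pmf s"
      unfolding r[symmetric] s[symmetric] by force
    then have "finite (set_pmf j)" using fin by (meson finite_SigmaI finite_subset)
    then show "finite (set_pmf u)" by (simp add: u_def)
    show "map_pmf fstG u = map_pmf fstG r"
      unfolding u_def r[symmetric] map_pmf_comp by (intro map_pmf_cong refl) (auto dest!: j simp: G)
    show "map_pmf sndG u = map_pmf sndG s"
      unfolding u_def s[symmetric] map_pmf_comp by (intro map_pmf_cong refl) (auto dest!: j simp: G)
    fix \<theta> :: real assume l: "0 < \<theta>" "\<theta> < 1"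
    have "transport_cost (mix u) \<le> (\<integral>\<^sup>+x. ennreal (1 / \<theta>) * transport_cost (law (fst x)) +
       ennreal (1 / (1 - \<theta>)) * transport_cost (law (snd x)) \<partial>measure_pmf j)"
      unfolding transport_cost_mix u_def nn_integral_map_pmf
      by (intro nn_integral_mono_AE) (use G(3) j l in \<open>auto simp: AE_measure_pmf_iff\<close>)
    also have "\<dots> = ennreal (1 / \<theta>) * transport_cost (mix r) + ennreal (1 / (1 - \<theta>)) * transport_cost (mix s)"
      unfolding transport_cost_mix r[symmetric] s[symmetric] nn_integral_map_pmf
      by (subst nn_integral_add) (auto simp: nn_integral_cmult)
    finally show "transport_cost (mix u) \<le>
       ennreal (1 / \<theta>) * transport_cost (mix r) + ennreal (1 / (1 - \<theta>)) * transport_cost (mix s)" .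
  qed
qed

section \<open>Existence of optimal couplings\<close>

text \<open>
  By \<open>transport_cost_law\<close> only the covariance of the coupling matters. Covariances whose diagonal
  blocks are those of \<open>g\<close> and \<open>h\<close> form a closed set of operators; it is bounded because the diagonal
  blocks bound the quadratic form and the quadratic form bounds the operator by Cauchy-Schwarz. A
  minimiser of the cost on this compact set is the covariance of a Gaussian law by \<open>gaussian_exists\<close>.
\<close>
theorem optimal_gaussian_coupling:
  fixes g h :: "'a::euclidean_space gauss"
  obtains P where "fstG P = g" "sndG P = h"
    "\<And>Q. fstG Q = g \<Longrightarrow> sndG Q = h \<Longrightarrow> transport_cost (law P) \<le> transport_cost (law Q)"
proof -
  define \<K> :: "(('a \<times> 'a) \<Rightarrow>\<^sub>L ('a \<times> 'a)) set" where
    "\<K> = {T. (\<forall>x y. blinfun_apply T x \<bullet> y = x \<bullet> blinfun_apply T y) \<and> (\<forall>x. 0 \<le> x \<bullet> blinfun_apply T x) \<and>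
       (\<forall>x. fst (blinfun_apply T (x, 0)) = cov g x) \<and> (\<forall>y. snd (blinfun_apply T (0, y)) = cov h y)}"
  have op: "covariance_operator (blinfun_apply T)" if "T \<in> \<K>" for T
    using that unfolding \<K>_def covariance_operator_def by (auto intro: bounded_linear.linear[OF blinfun.bounded_linear_right])
  have mem: "Blinfun (cov Q) \<in> \<K>" "blinfun_apply (Blinfun (cov Q)) = cov Q"
    if "fstG Q = g" "sndG Q = h" for Q
  proof -
    have "bounded_linear (cov Q)" using linear_cov by (simp add: linear_conv_bounded_linear)
    then show eq: "blinfun_apply (Blinfun (cov Q)) = cov Q" by (rule bounded_linear_Blinfun_apply)
    show "Blinfun (cov Q) \<in> \<K>"
      unfolding \<K>_def that[symmetric]
      by (simp add: eq cov_symmetric cov_nonneg cov_fstG cov_sndG del: split_paired_All)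
  qed
  have "closed \<K>"
  proof -
    note cont = continuous_on_fst continuous_on_snd continuous_on_inner continuous_on_const
      blinfun.continuous_on[OF continuous_on_id]
    have "closed {T. \<forall>x y. blinfun_apply T x \<bullet> y = x \<bullet> blinfun_apply (T :: ('a \<times> 'a) \<Rightarrow>\<^sub>L ('a \<times> 'a)) y}"
      by (intro closed_Collect_all closed_Collect_eq cont)
    moreover have "closed {T. \<forall>x. 0 \<le> x \<bullet> blinfun_apply (T :: ('a \<times> 'a) \<Rightarrow>\<^sub>L ('a \<times> 'a)) x}"
      by (intro closed_Collect_all closed_Collect_le cont)
    moreover have "closed {T. \<forall>x. fst (blinfun_apply (T :: ('a \<times> 'a) \<Rightarrow>\<^sub>L ('a \<times> 'a)) (x, 0)) = cov g x}"
      by (intro closed_Collect_all closed_Collect_eq cont)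
    moreover have "closed {T. \<forall>y. snd (blinfun_apply (T :: ('a \<times> 'a) \<Rightarrow>\<^sub>L ('a \<times> 'a)) (0, y)) = cov h y}"
      by (intro closed_Collect_all closed_Collect_eq cont)
    ultimately show ?thesis
      unfolding \<K>_def by (intro closed_Collect_conj)
  qed
  moreover have "bounded \<K>"
  proof -
    obtain A B where A: "A > 0" "\<And>x. norm (cov g x) \<le> A * norm x" and B: "B > 0" "\<And>x. norm (cov h x) \<le> B * norm x"
      using linear_bounded_pos[OF linear_cov, of g] linear_bounded_pos[OF linear_cov, of h] by metis
    define M where "M = 2 * (A + B)"
    have "norm T \<le> M" if T: "T \<in> \<K>" for T
    proof (rule norm_blinfun_bound)
      show "0 \<le> M" using A(1) B(1) by (simp add: M_def)
      fix z
      define q where "q z = z \<bullet> blinfun_apply T z" for z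
      have q0: "0 \<le> q z" for z using op[OF T] unfolding covariance_operator_def q_def by blast
      have qM: "q z \<le> M * (norm z)\<^sup>2" for z
      proof -
        obtain a b where z: "z = (a, b)" by fastforce
        \<comment> \<open>The parallelogram law bounds the form by twice the sum of its diagonal blocks.\<close>
        have "q ((a, 0) + (0, b)) + q ((a, 0) - (0, b)) = 2 * q (a, 0) + 2 * q (0, b)"
          unfolding q_def by (simp only: blinfun.add_right blinfun.diff_right inner_add_left inner_add_right
              inner_diff_left inner_diff_right)
        then have "q z \<le> 2 * q (a, 0) + 2 * q (0, b)"
          using q0[of "(a, 0) - (0, b)"] by (simp add: z)
        moreover have "q (a, 0) = a \<bullet> cov g a" "q (0, b) = b \<bullet> cov h b"
          using T by (auto simp: q_def \<K>_def inner_prod_def)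
        moreover have "a \<bullet> cov g a \<le> norm a * (A * norm a)"
          by (rule order_trans[OF norm_cauchy_schwarz]) (intro mult_left_mono A norm_ge_zero)
        moreover have "b \<bullet> cov h b \<le> norm b * (B * norm b)"
          by (rule order_trans[OF norm_cauchy_schwarz]) (intro mult_left_mono B norm_ge_zero)
        moreover have "norm a * (A * norm a) \<le> A * (norm z)\<^sup>2" "norm b * (B * norm b) \<le> B * (norm z)\<^sup>2"
          using A(1) B(1) by (simp_all add: z norm_Pair power2_eq_square[symmetric] mult.left_commute)
        ultimately show ?thesis by (simp add: M_def algebra_simps)
      qed
      define w where "w = blinfun_apply T z"
      have "((norm w)\<^sup>2)\<^sup>2 = (w \<bullet> blinfun_apply T z)\<^sup>2" by (simp add: w_def power2_norm_eq_inner)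
      also have "\<dots> \<le> q w * q z"
        unfolding q_def by (rule covariance_operator_cauchy_schwarz[OF op[OF T]])
      also have "\<dots> \<le> (M * (norm w)\<^sup>2) * (M * (norm z)\<^sup>2)"
        by (intro mult_mono qM q0 mult_nonneg_nonneg) (use A(1) B(1) in \<open>auto simp: M_def\<close>)
      finally have "(norm w)\<^sup>2 * (norm w)\<^sup>2 \<le> (norm w)\<^sup>2 * (M * norm z)\<^sup>2"
        by (simp add: power2_eq_square mult_ac)
      then have "(norm w)\<^sup>2 \<le> (M * norm z)\<^sup>2"
        by (cases "w = 0") (simp, erule mult_left_le_imp_le, simp)
      then show "norm (blinfun_apply T z) \<le> M * norm z"
        unfolding w_def by (rule power2_le_imp_le) (use A(1) B(1) in \<open>simp add: M_def\<close>)
    qed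
    then show ?thesis by (auto simp: bounded_iff)
  qed
  ultimately have "compact \<K>" by (simp add: compact_eq_bounded_closed)
  moreover have "\<K> \<noteq> {}" using mem(1)[OF fstG_pairG sndG_pairG] by blast
  moreover have "continuous_on \<K> (\<lambda>T. \<Sum>b\<in>Basis. (b, - b) \<bullet> blinfun_apply T (b, - b))"
    by (intro continuous_intros)
  ultimately have "\<exists>T\<in>\<K>. \<forall>T'\<in>\<K>. (\<Sum>b\<in>Basis. (b, - b) \<bullet> blinfun_apply T (b, - b))
      \<le> (\<Sum>b\<in>Basis. (b, - b) \<bullet> blinfun_apply T' (b, - b))"
    by (rule continuous_attains_inf)
  then obtain T where T: "T \<in> \<K>" and
    min: "\<And>T'. T' \<in> \<K> \<Longrightarrow> (\<Sum>b\<in>Basis. (b, - b) \<bullet> blinfun_apply T (b, - b))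
      \<le> (\<Sum>b\<in>Basis. (b, - b) \<bullet> blinfun_apply T' (b, - b))"
    by blast
  obtain M where "gaussian (mean g, mean h) (blinfun_apply T) M"
    using gaussian_exists[OF op[OF T]] by blast
  then have "gaussian (mean g, mean h) (blinfun_apply T) (law (Gauss M))" by (simp add: law_Gauss)
  note P = mean_cov_eqI[OF this]
  show thesis
  proof (rule that)
    show "fstG (Gauss M) = g" "sndG (Gauss M) = h"
      using T by (auto intro!: gauss_eqI simp: mean_fstG mean_sndG cov_fstG cov_sndG P \<K>_def fun_eq_iff)
    fix Q assume Q: "fstG Q = g" "sndG Q = h"
    have "mean Q = (mean g, mean h)" using Q by (auto simp: prod_eq_iff simp flip: mean_fstG mean_sndG)
    then show "transport_cost (law (Gauss M)) \<le> transport_cost (law Q)"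
      unfolding transport_cost_law P using min[OF mem(1)[OF Q]] by (intro ennreal_leI) (simp add: mem(2)[OF Q])
  qed
qed

lemma pmf_marginals_finite:
  assumes "finite A" "finite B" "set_pmf r \<subseteq> A \<times> B"
  shows "pmf (map_pmf fst r) a = (\<Sum>b\<in>B. pmf r (a, b))"
    and "pmf (map_pmf snd r) b = (\<Sum>a\<in>A. pmf r (a, b))"
proof -
  have "pmf (map_pmf fst r) a = measure (measure_pmf r) ((fst -` {a}) \<inter> set_pmf r)"
    by (simp add: pmf_map measure_Int_set_pmf)
  also have "(fst -` {a}) \<inter> set_pmf r = ({a} \<times> B) \<inter> set_pmf r" using assms(3) by auto
  also have "measure (measure_pmf r) \<dots> = (\<Sum>x\<in>{a} \<times> B. pmf r x)"
    using assms(2) by (simp only: measure_Int_set_pmf) (rule measure_measure_pmf_finite, simp)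
  also have "\<dots> = (\<Sum>b\<in>B. pmf r (a, b))" by (simp add: sum.cartesian_product')
  finally show "pmf (map_pmf fst r) a = (\<Sum>b\<in>B. pmf r (a, b))" .
  have "pmf (map_pmf snd r) b = measure (measure_pmf r) ((snd -` {b}) \<inter> set_pmf r)"
    by (simp add: pmf_map measure_Int_set_pmf)
  also have "(snd -` {b}) \<inter> set_pmf r = (A \<times> {b}) \<inter> set_pmf r" using assms(3) by auto
  also have "measure (measure_pmf r) \<dots> = (\<Sum>x\<in>A \<times> {b}. pmf r x)"
    using assms(1) by (simp only: measure_Int_set_pmf) (rule measure_measure_pmf_finite, simp)
  also have "\<dots> = (\<Sum>a\<in>A. pmf r (a, b))" by (simp add: sum.cartesian_product')
  finally show "pmf (map_pmf snd r) b = (\<Sum>a\<in>A. pmf r (a, b))" .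
qed

text \<open>
  The weights of a coupling form a closed subset of a cube, which is compact in the product
  topology even though the index type may be infinite. A minimiser in \<open>\<K>\<close> may put weight outside
  \<open>A \<times> B\<close>, where no constraint acts, but its values on \<open>A \<times> B\<close> already sum to \<open>1\<close>, so \<open>r\<close> uses only those.
\<close>
theorem optimal_finite_coupling:
  fixes p :: "'a pmf" and q :: "'b pmf" and c :: "'a \<times> 'b \<Rightarrow> real"
  assumes "finite (set_pmf p)" "finite (set_pmf q)"
  obtains r where "map_pmf fst r = p" "map_pmf snd r = q"
    "\<And>s. map_pmf fst s = p \<Longrightarrow> map_pmf snd s = q \<Longrightarrow>
       measure_pmf.expectation r c \<le> measure_pmf.expectation s c"
proof -
  define A B where "A = set_pmf p" and "B = set_pmf q"
  have fin: "finite A" "finite B" "finite (A \<times> B)" using assms by (auto simp: A_def B_def)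
  define \<K> :: "('a \<times> 'b \<Rightarrow> real) set" where
    "\<K> = (UNIV \<rightarrow>\<^sub>E {0..1}) \<inter> {w. (\<forall>a\<in>A. (\<Sum>b\<in>B. w (a, b)) = pmf p a) \<and> (\<forall>b\<in>B. (\<Sum>a\<in>A. w (a, b)) = pmf q b)}"
  have supp: "set_pmf s \<subseteq> A \<times> B" if "map_pmf fst s = p" "map_pmf snd s = q" for s
    unfolding A_def B_def that[symmetric] by force
  have exp: "measure_pmf.expectation s c = (\<Sum>x\<in>A \<times> B. c x * pmf s x)" if "set_pmf s \<subseteq> A \<times> B" for s
    using that fin by (intro integral_measure_pmf_real) auto
  have mem: "pmf s \<in> \<K>" if "map_pmf fst s = p" "map_pmf snd s = q" for s
    using pmf_marginals_finite[OF fin(1,2) supp[OF that]] unfolding that \<K>_def by (auto simp: pmf_le_1)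
  have cont: "continuous_on X (\<lambda>w::'a \<times> 'b \<Rightarrow> real. w x)" for X x
    by (rule continuous_on_subset[OF continuous_on_product_coordinates]) simp
  have "compact (UNIV \<rightarrow>\<^sub>E {0..1} :: ('a \<times> 'b \<Rightarrow> real) set)"
    using compactin_PiE[of "\<lambda>_. euclidean" UNIV "\<lambda>_::'a\<times>'b. {0..1::real}"]
    unfolding euclidean_product_topology compactin_euclidean_iff by simp
  moreover have "closed {w :: 'a \<times> 'b \<Rightarrow> real. (\<forall>a\<in>A. (\<Sum>b\<in>B. w (a, b)) = pmf p a) \<and> (\<forall>b\<in>B. (\<Sum>a\<in>A. w (a, b)) = pmf q b)}"
    unfolding Ball_def imp_conv_disj
    by (intro closed_Collect_conj closed_Collect_all closed_Collect_disj closed_Collect_eq closed_Collect_const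
        continuous_intros cont)
  ultimately have "compact \<K>" unfolding \<K>_def by (rule compact_Int_closed)
  moreover have "pmf (pair_pmf p q) \<in> \<K>" by (rule mem) (simp_all add: map_fst_pair_pmf map_snd_pair_pmf)
  then have "\<K> \<noteq> {}" by blast
  moreover have "continuous_on \<K> (\<lambda>w. \<Sum>x\<in>A \<times> B. c x * w x)"
    by (intro continuous_intros cont)
  ultimately have "\<exists>w\<in>\<K>. \<forall>v\<in>\<K>. (\<Sum>x\<in>A \<times> B. c x * w x) \<le> (\<Sum>x\<in>A \<times> B. c x * v x)"
    by (rule continuous_attains_inf)
  then obtain w where w: "w \<in> \<K>" and
    min: "\<And>v. v \<in> \<K> \<Longrightarrow> (\<Sum>x\<in>A \<times> B. c x * w x) \<le> (\<Sum>x\<in>A \<times> B. c x * v x)"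
    by blast
  have w1: "(\<Sum>b\<in>B. w (a, b)) = pmf p a" if "a \<in> A" for a using w that by (auto simp: \<K>_def)
  have w2: "(\<Sum>a\<in>A. w (a, b)) = pmf q b" if "b \<in> B" for b using w that by (auto simp: \<K>_def)
  have "(\<Sum>x\<in>A \<times> B. w x) = (\<Sum>a\<in>A. pmf p a)"
    using w1 by (simp add: sum.cartesian_product')
  also have "\<dots> = 1" using fin by (auto simp: A_def intro!: sum_pmf_eq_1)
  finally have sum1: "(\<Sum>x\<in>A \<times> B. w x) = 1" .
  have "0 \<le> w x" for x using w by (cases x) (auto simp: \<K>_def PiE_def Pi_def)
  then obtain r where r: "set_pmf r \<subseteq> A \<times> B" "\<And>x. x \<in> A \<times> B \<Longrightarrow> pmf r x = w x"
    using pmf_of_finite_weights[OF fin(3) _ sum1] by blast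
  note marg = pmf_marginals_finite[OF fin(1,2) r(1)]
  show thesis
  proof (rule that)
    show "map_pmf fst r = p"
    proof (rule pmf_eqI)
      fix a show "pmf (map_pmf fst r) a = pmf p a"
      proof (cases "a \<in> A")
        case True then show ?thesis using r w1 by (simp add: marg)
      next
        case False
        then have "a \<notin> set_pmf (map_pmf fst r)" "a \<notin> set_pmf p" using r(1) by (auto simp: A_def)
        then show ?thesis unfolding set_pmf_iff by simp
      qed
    qed
    show "map_pmf snd r = q"
    proof (rule pmf_eqI)
      fix b show "pmf (map_pmf snd r) b = pmf q b"
      proof (cases "b \<in> B")
        case True then show ?thesis using r w2 by (simp add: marg)
      next
        case False
        then have "b \<notin> set_pmf (map_pmf snd r)" "b \<notin> set_pmf q" using r(1) by (auto simp: B_def)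
        then show ?thesis unfolding set_pmf_iff by simp
      qed
    qed
    fix s assume s: "map_pmf fst s = p" "map_pmf snd s = q"
    show "measure_pmf.expectation r c \<le> measure_pmf.expectation s c"
      using min[OF mem[OF s]] r(2) by (simp add: exp[OF r(1)] exp[OF supp[OF s]])
  qed
qed

text \<open>
  Replacing each component of a coupling by the optimal Gaussian coupling of its two marginals does
  not increase the cost, which leaves a transport problem between \<open>p\<close> and \<open>q\<close> with a fixed cost
  function.
\<close>
theorem optimal_mixture_coupling:
  fixes p q :: "'a::euclidean_space gauss pmf"
  assumes fin: "finite (set_pmf p)" "finite (set_pmf q)"
  obtains r where "finite (set_pmf r)" "map_pmf fstG r = p" "map_pmf sndG r = q"
    "transport_cost (mix r) < \<top>"
    "\<And>s. finite (set_pmf s) \<Longrightarrow> map_pmf fstG s = p \<Longrightarrow> map_pmf sndG s = q \<Longrightarrow>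
       transport_cost (mix r) \<le> transport_cost (mix s)"
proof -
  have "\<exists>Opt. \<forall>g h :: 'a gauss. fstG (Opt g h) = g \<and> sndG (Opt g h) = h \<and>
    (\<forall>Q. fstG Q = g \<longrightarrow> sndG Q = h \<longrightarrow> transport_cost (law (Opt g h)) \<le> transport_cost (law Q))"
    using optimal_gaussian_coupling by metis
  then obtain Opt :: "'a gauss \<Rightarrow> 'a gauss \<Rightarrow> ('a \<times> 'a) gauss" where
    Opt: "\<And>g h. fstG (Opt g h) = g" "\<And>g h. sndG (Opt g h) = h"
    "\<And>Q. transport_cost (law (Opt (fstG Q) (sndG Q))) \<le> transport_cost (law Q)"
    by blast
  define c where "c x = enn2real (transport_cost (law (case_prod Opt x)))" for x
  have c: "transport_cost (law (case_prod Opt x)) = ennreal (c x)" for x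
    by (simp add: c_def transport_cost_law_finite)
  have c0: "0 \<le> c x" for x by (simp add: c_def)
  obtain r where r: "map_pmf fst r = p" "map_pmf snd r = q"
    "\<And>s. map_pmf fst s = p \<Longrightarrow> map_pmf snd s = q \<Longrightarrow>
       measure_pmf.expectation r c \<le> measure_pmf.expectation s c"
    using optimal_finite_coupling[OF fin] by metis
  have "set_pmf r \<subseteq> set_pmf p \<times> set_pmf q" unfolding r(1,2)[symmetric] by force
  then have finr: "finite (set_pmf r)" using fin by (meson finite_SigmaI finite_subset)
  have cost: "transport_cost (mix (map_pmf (case_prod Opt) r)) = ennreal (measure_pmf.expectation r c)"
    by (simp add: transport_cost_mix c c0 nn_integral_eq_integral integrable_measure_pmf_finite[OF finr])
  show thesis
  proof (rule that)
    show "finite (set_pmf (map_pmf (case_prod Opt) r))" using finr by simp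
    show "map_pmf fstG (map_pmf (case_prod Opt) r) = p"
      unfolding r(1)[symmetric] map_pmf_comp by (intro map_pmf_cong refl) (auto simp: Opt)
    show "map_pmf sndG (map_pmf (case_prod Opt) r) = q"
      unfolding r(2)[symmetric] map_pmf_comp by (intro map_pmf_cong refl) (auto simp: Opt)
    show "transport_cost (mix (map_pmf (case_prod Opt) r)) < \<top>" by (simp add: cost)
    fix s :: "('a \<times> 'a) gauss pmf" assume s: "finite (set_pmf s)" "map_pmf fstG s = p" "map_pmf sndG s = q"
    define s' where "s' = map_pmf (\<lambda>P. (fstG P, sndG P)) s"
    have s': "map_pmf fst s' = p" "map_pmf snd s' = q" "finite (set_pmf s')"
      using s by (simp_all add: s'_def map_pmf_comp)
    have "transport_cost (mix (map_pmf (case_prod Opt) r)) \<le> ennreal (measure_pmf.expectation s' c)"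
      unfolding cost by (rule ennreal_leI[OF r(3)[OF s'(1,2)]])
    also have "\<dots> = (\<integral>\<^sup>+x. ennreal (c x) \<partial>measure_pmf s')"
      by (simp add: c0 nn_integral_eq_integral integrable_measure_pmf_finite[OF s'(3)])
    also have "\<dots> = (\<integral>\<^sup>+P. transport_cost (law (Opt (fstG P) (sndG P))) \<partial>measure_pmf s)"
      by (simp add: s'_def c[symmetric])
    also have "\<dots> \<le> transport_cost (mix s)"
      unfolding transport_cost_mix by (intro nn_integral_mono Opt)
    finally show "transport_cost (mix (map_pmf (case_prod Opt) r)) \<le> transport_cost (mix s)" .
  qed
qed

section \<open>The metric and its geodesics\<close>

lemma MW2_squared_eq_INF:
  "MW2_squared \<mu> \<nu> = (INF \<gamma> \<in> couplings \<mu> \<nu> \<inter> GMM_infinity. transport_cost \<gamma>)"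
  by (simp add: MW2_squared_def transport_cost_def)

lemma MW2_nonneg: "0 \<le> MW2 \<mu> \<nu>"
  by (simp add: MW2_def)

text \<open>
  Attainment also shows that the infimum is finite, so that \<open>MW2\<close> is really its square root rather
  than the default value of \<open>enn2real\<close> at \<open>\<top>\<close>.
\<close>
lemma MW2_squared_mix_attained:
  fixes p q :: "'a::euclidean_space gauss pmf"
  assumes fin: "finite (set_pmf p)" "finite (set_pmf q)"
  obtains r where "finite (set_pmf r)" "map_pmf fstG r = p" "map_pmf sndG r = q"
    "transport_cost (mix r) = MW2_squared (mix p) (mix q)"
    "MW2_squared (mix p) (mix q) = ennreal ((MW2 (mix p) (mix q))\<^sup>2)"
proof -
  obtain r where r: "finite (set_pmf r)" "map_pmf fstG r = p" "map_pmf sndG r = q"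
    "transport_cost (mix r) < \<top>"
    and opt: "\<And>s. finite (set_pmf s) \<Longrightarrow> map_pmf fstG s = p \<Longrightarrow> map_pmf sndG s = q \<Longrightarrow>
       transport_cost (mix r) \<le> transport_cost (mix s)"
    using optimal_mixture_coupling[OF fin] by blast
  have cost: "transport_cost (mix r) = MW2_squared (mix p) (mix q)"
    unfolding MW2_squared_eq_INF GMM_couplings_eq[OF fin]
    by (rule antisym) (use r opt in \<open>auto intro!: INF_lower2 INF_greatest\<close>)
  then have "MW2_squared (mix p) (mix q) = ennreal ((MW2 (mix p) (mix q))\<^sup>2)"
    using r(4) by (auto simp: MW2_def)
  with r(1-3) cost show thesis by (rule that)
qed

lemma optimal_GMM_coupling:
  assumes "\<mu> \<in> GMM_infinity" "\<nu> \<in> GMM_infinity"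
  obtains \<gamma> where "\<gamma> \<in> couplings \<mu> \<nu> \<inter> GMM_infinity"
    "transport_cost \<gamma> = MW2_squared \<mu> \<nu>" "MW2_squared \<mu> \<nu> = ennreal ((MW2 \<mu> \<nu>)\<^sup>2)"
proof -
  obtain p q where p: "finite (set_pmf p)" "\<mu> = mix p" and q: "finite (set_pmf q)" "\<nu> = mix q"
    using assms unfolding GMM_infinity_eq by blast
  obtain r where r: "finite (set_pmf r)" "map_pmf fstG r = p" "map_pmf sndG r = q"
    and cost: "transport_cost (mix r) = MW2_squared (mix p) (mix q)"
      "MW2_squared (mix p) (mix q) = ennreal ((MW2 (mix p) (mix q))\<^sup>2)"
    using MW2_squared_mix_attained[OF p(1) q(1)] .
  have "mix r \<in> couplings \<mu> \<nu> \<inter> GMM_infinity"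
    unfolding p(2) q(2) GMM_couplings_eq[OF p(1) q(1)] using r by blast
  from this cost[folded p(2) q(2)] show thesis by (rule that)
qed

lemma MW2_squared_finite:
  assumes "\<mu> \<in> GMM_infinity" "\<nu> \<in> GMM_infinity"
  shows "MW2_squared \<mu> \<nu> < \<top>"
  by (rule optimal_GMM_coupling[OF assms]) simp

lemma MW2_le:
  assumes "\<gamma> \<in> couplings \<mu> \<nu>" "\<gamma> \<in> GMM_infinity" "transport_cost \<gamma> \<le> ennreal (x\<^sup>2)" "0 \<le> x"
  shows "MW2 \<mu> \<nu> \<le> x"
proof -
  have "MW2_squared \<mu> \<nu> \<le> transport_cost \<gamma>"
    unfolding MW2_squared_eq_INF using assms(1,2) by (intro INF_lower) blast
  also note assms(3)
  finally have "enn2real (MW2_squared \<mu> \<nu>) \<le> x\<^sup>2"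
    using enn2real_mono[of "MW2_squared \<mu> \<nu>" "ennreal (x\<^sup>2)"] by simp
  then show ?thesis
    unfolding MW2_def using assms(4) real_le_lsqrt by (simp add: real_sqrt_le_iff real_le_lsqrt)
qed

lemma GMM_infinity_linear_image:
  assumes "\<mu> \<in> GMM_infinity" "linear L"
  shows "distr \<mu> borel L \<in> GMM_infinity"
proof -
  obtain p where "finite (set_pmf p)" "\<mu> = mix p" using assms(1) unfolding GMM_infinity_eq by blast
  then show ?thesis
    unfolding GMM_infinity_eq by (auto simp: distr_mix[OF assms(2)] intro!: imageI)
qed

lemma GMM_infinityD:
  assumes "\<mu> \<in> GMM_infinity"
  shows "prob_space \<mu>" "sets \<mu> = sets borel"
  using assms unfolding GMM_infinity_eq by (auto simp: prob_space_mix)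

lemma linear_image_coupling:
  fixes \<gamma> :: "'b::euclidean_space measure" and f g :: "'b \<Rightarrow> 'a::euclidean_space"
  assumes "\<gamma> \<in> GMM_infinity" "linear f" "linear g"
  shows "distr \<gamma> borel (\<lambda>z. (f z, g z)) \<in> couplings (distr \<gamma> borel f) (distr \<gamma> borel g)"
    and "distr \<gamma> borel (\<lambda>z. (f z, g z)) \<in> GMM_infinity"
    and "transport_cost (distr \<gamma> borel (\<lambda>z. (f z, g z))) = (\<integral>\<^sup>+z. ennreal ((norm (f z - g z))\<^sup>2) \<partial>\<gamma>)"
proof -
  note sets[measurable_cong] = GMM_infinityD(2)[OF assms(1)]
  have lin: "linear (\<lambda>z. (f z, g z))" using assms(2,3) by (auto simp: linear_iff)
  have [measurable]: "(\<lambda>z. (f z, g z)) \<in> borel_measurable borel"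
    "(fst :: 'a \<times> 'a \<Rightarrow> 'a) \<in> borel_measurable borel" "(snd :: 'a \<times> 'a \<Rightarrow> 'a) \<in> borel_measurable borel"
    using borel_measurable_linear lin linear_fst_proj linear_snd_proj by blast+
  have m: "(\<lambda>z. (f z, g z)) \<in> \<gamma> \<rightarrow>\<^sub>M borel" by simp
  show "distr \<gamma> borel (\<lambda>z. (f z, g z)) \<in> GMM_infinity"
    using GMM_infinity_linear_image[OF assms(1) lin] .
  show "distr \<gamma> borel (\<lambda>z. (f z, g z)) \<in> couplings (distr \<gamma> borel f) (distr \<gamma> borel g)"
    unfolding couplings_def using prob_space.prob_space_distr[OF GMM_infinityD(1)[OF assms(1)] m]
    by (simp add: distr_distr[OF _ m] o_def)
  show "transport_cost (distr \<gamma> borel (\<lambda>z. (f z, g z))) = (\<integral>\<^sup>+z. ennreal ((norm (f z - g z))\<^sup>2) \<partial>\<gamma>)"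
    unfolding transport_cost_def
    by (subst nn_integral_distr[OF m]) (simp_all add: borel_measurable_dist_sq linear_fst_proj linear_snd_proj)
qed

text \<open>
  Exchanging the coordinates of a coupling works for arbitrary measures \<open>\<mu>\<close> and \<open>\<nu>\<close>, mixtures or not;
  this generality matters because the locale \<open>Metric_space\<close> asks for symmetry on the whole type.
\<close>
lemma MW2_commute: "MW2 \<mu> \<nu> = MW2 \<nu> \<mu>"
proof -
  have le: "MW2_squared \<nu> \<mu> \<le> MW2_squared \<mu> \<nu>" for \<mu> \<nu> :: "'a::euclidean_space measure"
    unfolding MW2_squared_eq_INF[of \<mu> \<nu>]
  proof (rule INF_greatest)
    fix \<gamma> assume \<gamma>: "\<gamma> \<in> couplings \<mu> \<nu> \<inter> GMM_infinity"
    note swap = linear_image_coupling[OF _ linear_snd_proj linear_fst_proj, of \<gamma>]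
    have "distr \<gamma> borel (\<lambda>z. (snd z, fst z)) \<in> couplings \<nu> \<mu> \<inter> GMM_infinity"
      using swap(1,2) \<gamma> by (auto simp: couplings_def)
    then have "MW2_squared \<nu> \<mu> \<le> transport_cost (distr \<gamma> borel (\<lambda>z. (snd z, fst z)))"
      unfolding MW2_squared_eq_INF by (rule INF_lower)
    also have "\<dots> = transport_cost \<gamma>"
      using swap(3) \<gamma> by (simp add: transport_cost_def norm_minus_commute)
    finally show "MW2_squared \<nu> \<mu> \<le> transport_cost \<gamma>" .
  qed
  have "MW2_squared \<mu> \<nu> = MW2_squared \<nu> \<mu>" by (intro antisym le)
  then show ?thesis by (simp add: MW2_def)
qed

lemma MW2_self:
  assumes "\<mu> \<in> GMM_infinity"
  shows "MW2 \<mu> \<mu> = 0"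
proof -
  have id: "linear (\<lambda>x::'a. x)" by (auto simp: linear_iff)
  have "distr \<mu> borel (\<lambda>x. x) = \<mu>" by (rule distr_id2) (simp add: GMM_infinityD(2)[OF assms])
  then have "MW2 \<mu> \<mu> \<le> 0"
    using linear_image_coupling[OF assms id id] by (intro MW2_le) auto
  then show ?thesis using MW2_nonneg[of \<mu> \<mu>] by simp
qed

text \<open>
  An optimal coupling exists, and if its cost is zero it is concentrated on the diagonal, where the
  two projections coincide.
\<close>
lemma MW2_eq_0_imp_eq:
  assumes "\<mu> \<in> GMM_infinity" "\<nu> \<in> GMM_infinity" "MW2 \<mu> \<nu> = 0"
  shows "\<mu> = \<nu>"
proof -
  obtain \<gamma> where \<gamma>: "\<gamma> \<in> couplings \<mu> \<nu> \<inter> GMM_infinity"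
    and cost: "transport_cost \<gamma> = MW2_squared \<mu> \<nu>" "MW2_squared \<mu> \<nu> = ennreal ((MW2 \<mu> \<nu>)\<^sup>2)"
    using optimal_GMM_coupling[OF assms(1,2)] .
  then have sets: "sets \<gamma> = sets borel" and marg: "distr \<gamma> borel fst = \<mu>" "distr \<gamma> borel snd = \<nu>"
    by (auto simp: couplings_def)
  have "(\<lambda>z. ennreal ((norm (fst z - snd z))\<^sup>2)) \<in> borel_measurable \<gamma>"
    by (intro borel_measurable_dist_sq sets linear_fst_proj linear_snd_proj)
  then have "AE z in \<gamma>. fst z = snd z"
    using cost assms(3) by (simp add: transport_cost_def nn_integral_0_iff_AE)
  moreover have "fst \<in> \<gamma> \<rightarrow>\<^sub>M borel" "snd \<in> \<gamma> \<rightarrow>\<^sub>M borel"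
    using borel_measurable_linear[OF linear_fst_proj] borel_measurable_linear[OF linear_snd_proj]
    by (simp_all add: measurable_cong_sets[OF sets refl])
  ultimately have "distr \<gamma> borel fst = distr \<gamma> borel snd"
    by (intro distr_cong_AE) auto
  then show ?thesis by (simp add: marg)
qed

text \<open>
  Composing optimal couplings bounds the squared distance by \<open>a\<^sup>2 / \<theta> + b\<^sup>2 / (1 - \<theta>)\<close>. The best choice
  \<open>\<theta> = a / (a + b)\<close> may be degenerate, so \<open>a\<close> and \<open>b\<close> are first enlarged by \<open>e / 2\<close>.
\<close>
lemma MW2_triangle:
  assumes "\<mu> \<in> GMM_infinity" "\<nu> \<in> GMM_infinity" "\<xi> \<in> GMM_infinity"
  shows "MW2 \<mu> \<xi> \<le> MW2 \<mu> \<nu> + MW2 \<nu> \<xi>"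
proof -
  obtain p q l where fin: "finite (set_pmf p)" "finite (set_pmf q)" "finite (set_pmf l)"
    and eq: "\<mu> = mix p" "\<nu> = mix q" "\<xi> = mix l"
    using assms unfolding GMM_infinity_eq by blast
  define a b where "a = MW2 \<mu> \<nu>" and "b = MW2 \<nu> \<xi>"
  obtain r where r: "finite (set_pmf r)" "map_pmf fstG r = p" "map_pmf sndG r = q"
    and "transport_cost (mix r) = MW2_squared (mix p) (mix q)"
      "MW2_squared (mix p) (mix q) = ennreal ((MW2 (mix p) (mix q))\<^sup>2)"
    using MW2_squared_mix_attained[OF fin(1,2)] .
  then have costr: "transport_cost (mix r) = ennreal (a\<^sup>2)" by (simp add: a_def eq)
  obtain s where s: "finite (set_pmf s)" "map_pmf fstG s = q" "map_pmf sndG s = l"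
    and "transport_cost (mix s) = MW2_squared (mix q) (mix l)"
      "MW2_squared (mix q) (mix l) = ennreal ((MW2 (mix q) (mix l))\<^sup>2)"
    using MW2_squared_mix_attained[OF fin(2,3)] .
  then have costs: "transport_cost (mix s) = ennreal (b\<^sup>2)" by (simp add: b_def eq)
  have "map_pmf sndG r = map_pmf fstG s" using r s by simp
  from mixture_coupling_composition[OF r(1) s(1) this] obtain u where
    u: "finite (set_pmf u)" "map_pmf fstG u = p" "map_pmf sndG u = l" and
    cost: "\<And>\<theta>. 0 < \<theta> \<Longrightarrow> \<theta> < 1 \<Longrightarrow> transport_cost (mix u) \<le>
       ennreal (1 / \<theta>) * ennreal (a\<^sup>2) + ennreal (1 / (1 - \<theta>)) * ennreal (b\<^sup>2)"
    unfolding r(2) s(3) costr costs by blast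
  have u': "mix u \<in> couplings \<mu> \<xi> \<inter> GMM_infinity"
    unfolding eq GMM_couplings_eq[OF fin(1,3)] using u by blast
  have "MW2 \<mu> \<xi> \<le> a + b + e" if "0 < e" for e
  proof (rule MW2_le)
    define A B where "A = a + e / 2" and "B = b + e / 2"
    have A: "0 \<le> a" "a \<le> A" "0 < A" and B: "0 \<le> b" "b \<le> B" "0 < B"
      using that MW2_nonneg[of \<mu> \<nu>] MW2_nonneg[of \<nu> \<xi>] by (auto simp: A_def B_def a_def b_def)
    define \<theta> where "\<theta> = A / (A + B)"
    have \<theta>: "0 < \<theta>" "\<theta> < 1" "1 - \<theta> = B / (A + B)" using A B by (auto simp: \<theta>_def field_simps)
    have "transport_cost (mix u) \<le> ennreal (1 / \<theta>) * ennreal (a\<^sup>2) + ennreal (1 / (1 - \<theta>)) * ennreal (b\<^sup>2)"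
      using \<theta> by (intro cost)
    also have "\<dots> = ennreal (1 / \<theta> * a\<^sup>2 + 1 / (1 - \<theta>) * b\<^sup>2)"
      using \<theta>(1,2) by (subst ennreal_plus) (auto simp: ennreal_mult'[symmetric])
    also have "\<dots> \<le> ennreal ((a + b + e)\<^sup>2)"
    proof (rule ennreal_leI)
      have "1 / \<theta> * a\<^sup>2 + 1 / (1 - \<theta>) * b\<^sup>2 \<le> 1 / \<theta> * A\<^sup>2 + 1 / (1 - \<theta>) * B\<^sup>2"
        using A B \<theta>(1,2) by (intro add_mono mult_left_mono power_mono) auto
      also have "\<dots> = (A + B)\<^sup>2"
        unfolding \<theta>(3) using A(3) B(3) by (simp add: \<theta>_def power2_eq_square field_simps)
      also have "A + B = a + b + e" by (simp add: A_def B_def)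
      finally show "1 / \<theta> * a\<^sup>2 + 1 / (1 - \<theta>) * b\<^sup>2 \<le> (a + b + e)\<^sup>2" .
    qed
    finally show "transport_cost (mix u) \<le> ennreal ((a + b + e)\<^sup>2)" .
    show "0 \<le> a + b + e" using A B that by simp
  qed (use u' in auto)
  then show ?thesis unfolding a_def b_def by (rule field_le_epsilon)
qed

theorem Metric_space_MW2: "Metric_space GMM_infinity MW2"
proof
  show "MW2 \<mu> \<nu> = MW2 \<nu> \<mu>" for \<mu> \<nu> :: "'a measure" by (rule MW2_commute)
  show "MW2 \<mu> \<nu> = 0 \<longleftrightarrow> \<mu> = \<nu>" if "\<mu> \<in> GMM_infinity" "\<nu> \<in> GMM_infinity" for \<mu> \<nu> :: "'a measure"
    using MW2_self MW2_eq_0_imp_eq that by blast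
qed (fact MW2_nonneg MW2_triangle)+

text \<open>
  The image of an optimal coupling under \<open>z \<mapsto> (I s z, I t z)\<close> couples \<open>\<rho> s\<close> with \<open>\<rho> t\<close>. It is again a
  Gaussian mixture because the map is linear, and \<open>I s z - I t z = (t - s) (x - y)\<close> for \<open>z = (x, y)\<close>.
\<close>
lemma displacement_interpolation:
  fixes \<mu> \<nu> :: "'a::euclidean_space measure"
  assumes "\<mu> \<in> GMM_infinity" "\<nu> \<in> GMM_infinity"
  obtains \<rho> where "\<And>t. \<rho> t \<in> GMM_infinity" "\<rho> 0 = \<mu>" "\<rho> 1 = \<nu>"
    "\<And>s t. MW2 (\<rho> s) (\<rho> t) \<le> \<bar>s - t\<bar> * MW2 \<mu> \<nu>"
proof -
  obtain \<gamma> where "\<gamma> \<in> couplings \<mu> \<nu> \<inter> GMM_infinity"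
    and "transport_cost \<gamma> = MW2_squared \<mu> \<nu>" "MW2_squared \<mu> \<nu> = ennreal ((MW2 \<mu> \<nu>)\<^sup>2)"
    using optimal_GMM_coupling[OF assms] .
  then have \<gamma>: "\<gamma> \<in> couplings \<mu> \<nu>" "\<gamma> \<in> GMM_infinity"
    and cost: "transport_cost \<gamma> = ennreal ((MW2 \<mu> \<nu>)\<^sup>2)" by auto
  define I where "I t z = (1 - t) *\<^sub>R fst z + t *\<^sub>R snd z" for t :: real and z :: "'a \<times> 'a"
  have lin: "linear (I t)" for t by (auto simp: I_def linear_iff algebra_simps)
  define \<rho> where "\<rho> t = distr \<gamma> borel (I t)" for t
  show thesis
  proof (rule that)
    show "\<rho> t \<in> GMM_infinity" for t unfolding \<rho>_def by (rule GMM_infinity_linear_image[OF \<gamma>(2) lin])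
    have "I 0 = fst" "I 1 = snd" by (auto simp: I_def)
    then show "\<rho> 0 = \<mu>" "\<rho> 1 = \<nu>" using \<gamma>(1) by (auto simp: \<rho>_def couplings_def)
    fix s t
    have "norm (I s z - I t z) = \<bar>s - t\<bar> * norm (fst z - snd z)" for z
    proof -
      have "I s z - I t z = (t - s) *\<^sub>R (fst z - snd z)" by (simp add: I_def algebra_simps)
      then show ?thesis by (simp add: abs_minus_commute)
    qed
    then have "transport_cost (distr \<gamma> borel (\<lambda>z. (I s z, I t z))) =
      (\<integral>\<^sup>+z. ennreal ((s - t)\<^sup>2) * ennreal ((norm (fst z - snd z))\<^sup>2) \<partial>\<gamma>)"
      unfolding linear_image_coupling(3)[OF \<gamma>(2) lin lin] by (simp add: power_mult_distrib ennreal_mult)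
    also have "\<dots> = ennreal ((s - t)\<^sup>2) * transport_cost \<gamma>"
      unfolding transport_cost_def
      by (intro nn_integral_cmult borel_measurable_dist_sq GMM_infinityD(2)[OF \<gamma>(2)] linear_fst_proj linear_snd_proj)
    also have "\<dots> = ennreal ((\<bar>s - t\<bar> * MW2 \<mu> \<nu>)\<^sup>2)"
      by (simp add: cost ennreal_mult'[symmetric] power_mult_distrib)
    finally show "MW2 (\<rho> s) (\<rho> t) \<le> \<bar>s - t\<bar> * MW2 \<mu> \<nu>"
      unfolding \<rho>_def
      by (intro MW2_le[OF linear_image_coupling(1,2)[OF \<gamma>(2) lin lin]]) (auto simp: MW2_nonneg)
  qed
qed

text \<open>
  The Lipschitz bound makes the path continuous and bounds every polygonal length by a telescoping
  sum; the partition with a single interval shows that the length is at least the distance.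
\<close>
theorem geodesic_space_if_linear_paths:
  assumes "Metric_space M d"
    and path: "\<And>x y. x \<in> M \<Longrightarrow> y \<in> M \<Longrightarrow> \<exists>\<rho>. (\<forall>t. \<rho> t \<in> M) \<and> \<rho> 0 = x \<and> \<rho> 1 = y \<and>
      (\<forall>s t. d (\<rho> s) (\<rho> t) \<le> \<bar>s - t\<bar> * d x y)"
  shows "geodesic_space M d"
  unfolding geodesic_space_def
proof (intro ballI)
  interpret Metric_space M d by fact
  fix x y assume xy: "x \<in> M" "y \<in> M"
  obtain \<rho> where \<rho>: "\<And>t. \<rho> t \<in> M" "\<rho> 0 = x" "\<rho> 1 = y" and lip: "\<And>s t. d (\<rho> s) (\<rho> t) \<le> \<bar>s - t\<bar> * d x y"
    using path[OF xy] by blast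
  have "pathin mtopology \<rho>"
    unfolding pathin_def continuous_map_to_metric
  proof (intro ballI allI impI)
    fix s :: real and e :: real assume s: "s \<in> topspace (top_of_set {0..1})" and e: "0 < e"
    have D: "0 < d x y + 1" using nonneg[of x y] by linarith
    show "\<exists>U. openin (top_of_set {0..1}) U \<and> s \<in> U \<and> (\<forall>t\<in>U. \<rho> t \<in> mball (\<rho> s) e)"
    proof (intro exI conjI ballI)
      show "openin (top_of_set {0..1}) ({0..1} \<inter> ball s (e / (d x y + 1)))"
        by (intro openin_open_Int open_ball)
      show "s \<in> {0..1} \<inter> ball s (e / (d x y + 1))" using s e D by simp
      fix t assume "t \<in> {0..1} \<inter> ball s (e / (d x y + 1))"
      then have "\<bar>s - t\<bar> < e / (d x y + 1)" by (simp add: dist_real_def)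
      then have lt: "\<bar>s - t\<bar> * (d x y + 1) < e" using D by (simp add: pos_less_divide_eq)
      have "d (\<rho> s) (\<rho> t) \<le> \<bar>s - t\<bar> * (d x y + 1)"
        by (rule order_trans[OF lip mult_left_mono]) auto
      with lt show "\<rho> t \<in> mball (\<rho> s) e" using \<rho>(1) by (simp add: in_mball)
    qed
  qed
  moreover have "metric_length d \<rho> = ennreal (d x y)"
  proof (rule antisym)
    show "metric_length d \<rho> \<le> ennreal (d x y)"
      unfolding metric_length_def
    proof (intro SUP_least, clarify)
      fix N and t :: "nat \<Rightarrow> real" assume t: "t 0 = 0" "t N = 1" "\<forall>i<N. t i \<le> t (Suc i)"
      have "(\<Sum>i<N. d (\<rho> (t i)) (\<rho> (t (Suc i)))) \<le> (\<Sum>i<N. (t (Suc i) - t i) * d x y)"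
      proof (intro sum_mono)
        fix i assume "i \<in> {..<N}"
        then have "\<bar>t i - t (Suc i)\<bar> = t (Suc i) - t i" using t(3) by simp
        then show "d (\<rho> (t i)) (\<rho> (t (Suc i))) \<le> (t (Suc i) - t i) * d x y" using lip[of "t i" "t (Suc i)"] by simp
      qed
      also have "\<dots> = d x y"
        by (simp add: sum_distrib_right[symmetric] sum_lessThan_telescope t)
      finally show "ennreal (\<Sum>i<N. d (\<rho> (t i)) (\<rho> (t (Suc i)))) \<le> ennreal (d x y)" by (rule ennreal_leI)
    qed
    have "(1, real) \<in> {(N, t). t 0 = 0 \<and> t N = 1 \<and> (\<forall>i<N. t i \<le> t (Suc i))}" by simp
    then show "ennreal (d x y) \<le> metric_length d \<rho>"
      unfolding metric_length_def by (rule SUP_upper2) (simp add: \<rho>)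
  qed
  ultimately show "\<exists>\<rho>. pathin mtopology \<rho> \<and> \<rho> 0 = x \<and> \<rho> 1 = y \<and> metric_length d \<rho> = ennreal (d x y)"
    using \<rho>(2,3) by blast
qed

theorem proposition5:
  shows "(\<forall>\<mu>\<in>GMM_infinity. \<forall>\<nu>\<in>GMM_infinity.
            MW2_squared \<mu> (\<nu> :: (real ^ 'd) measure) < \<top>) \<and>
         Metric_space (GMM_infinity :: (real ^ 'd) measure set) MW2 \<and>
         geodesic_space (GMM_infinity :: (real ^ 'd) measure set) MW2"
proof (intro conjI ballI)
  show "Metric_space (GMM_infinity :: (real ^ 'd) measure set) MW2"
    by (rule Metric_space_MW2)
  then show "geodesic_space (GMM_infinity :: (real ^ 'd) measure set) MW2"
  proof (rule geodesic_space_if_linear_paths)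
    fix \<mu> \<nu> :: "(real ^ 'd) measure" assume "\<mu> \<in> GMM_infinity" "\<nu> \<in> GMM_infinity"
    then show "\<exists>\<rho>. (\<forall>t. \<rho> t \<in> GMM_infinity) \<and> \<rho> 0 = \<mu> \<and> \<rho> 1 = \<nu> \<and>
      (\<forall>s t. MW2 (\<rho> s) (\<rho> t) \<le> \<bar>s - t\<bar> * MW2 \<mu> \<nu>)"
      by (rule displacement_interpolation) blast
  qed
qed (rule MW2_squared_finite)

end
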